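(* Let $H\in\Theta$, $X\in\Gamma$ and $A\subseteq\mathrm{Hom}(W(X),H)$. Then $A$ is LG-definable if and only if $A$ is MT-definable.
   Context: Fix a variety $\Theta$, an infinite set of variables $X^0$, let $\Gamma$ be the set of finite subsets of $X^0$ and $\Gamma^*=\Gamma\cup\{X^0\}$; $W(X)$ is the free algebra of $\Theta$ over $X$. For $H\in\Theta$ and $X\in\Gamma^*$, $\mathrm{Hal}^X_\Theta(H)$ is the Boolean algebra of subsets of $\mathrm{Hom}(W(X),H)$ with quantifiers ($\mu\in\exists xA$ iff some $\nu\in A$ agrees with $\mu$ off $x$), equalities $[w\equiv w']_H=\{\mu:\mu(w)=\mu(w')\}$ and maps $s_*(A)=\{\mu:\mu\circ s\in A\}$ for homomorphisms $s:W(X)\to W(Y)$. The multi-sorted algebra of formulas $\Phi=(\Phi(X),X\in\Gamma^* )$ is the free Halmos algebra over the sets of formal equalities $w\equiv w'$, $w,w'\in W(X)$; $\mathrm{Val}^X_H$ are the components of the unique homomorphism $\Phi\to\mathrm{Hal}_\Theta(H)$ sending $w\equiv w'$ to $[w\equiv w']_H$. A point $\mu$ satisfies $u$ iff $\mu\in\mathrm{Val}^X_H(u)$; $\mathrm{LKer}(\mu)$ is the set of formulas satisfied by $\mu$. $\Phi(X^0)$ is the Lindenbaum–Tarski algebra of first-order formulas with equalities in the signature of $\Theta$ over variables $X^0$. For $X=\{x_1,\dots,x_n\}$, $u\in\Phi(X^0)$ is $X$-special if its free variables lie in $X$ and its bound variables lie in $X^0\setminus X$. An $X$-type over $H$ is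 a set of $X$-special formulas consistent with the elementary theory of $H$ (every finite subset is simultaneously satisfied by some point $W(X^0)\to H$). For $\mu:W(X)\to H$, $\mathrm{Tp}^H(\mu)$ is the set of $X$-special $u$ such that every $\eta:W(X^0)\to H$ with $\eta(x_i)=\mu(x_i)$ for all $i$ satisfies $u$. $A$ is LG-definable if $A=\{\mu:T\subseteq\mathrm{LKer}(\mu)\}$ for some $T\subseteq\Phi(X)$. $A$ is MT-definable if $A=\{\mu:T\subseteq\mathrm{Tp}^H(\mu)\}$ for some $X$-type $T$ over $H$.
   Formalization: For empty A only "MT-definable implies LG-definable" is stated: the empty set is always LG-definable (T={0}), but if H is finite, e.g. one-element, every X-type is realized, so the empty set is not MT-definable. *)

theory Defs
  imports Main "HOL-Library.FuncSet"
begin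

section \<open>Universal algebra: varieties and their free algebras\<close>

text \<open>
  A signature is an arity function \<open>ar :: 'f \<Rightarrow> nat\<close>.  The infinite set of variables
  \<open>X\<^sup>0\<close> is the universe of the type \<open>'v\<close>.
\<close>

datatype ('f, 'v) trm = Var 'v | App 'f "('f, 'v) trm list"

fun tvars :: "('f, 'v) trm \<Rightarrow> 'v set" where
  "tvars (Var x) = {x}"
| "tvars (App f ts) = (\<Union>t\<in>set ts. tvars t)"

fun tsubst :: "('v \<Rightarrow> ('f, 'v) trm) \<Rightarrow> ('f, 'v) trm \<Rightarrow> ('f, 'v) trm" where
  "tsubst \<sigma> (Var x) = \<sigma> x"
| "tsubst \<sigma> (App f ts) = App f (map (tsubst \<sigma>) ts)"

record ('f, 'a) alg =
  car :: "'a set"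
  opn :: "'f \<Rightarrow> 'a list \<Rightarrow> 'a"

fun eval :: "('f, 'a) alg \<Rightarrow> ('v \<Rightarrow> 'a) \<Rightarrow> ('f, 'v) trm \<Rightarrow> 'a" where
  "eval H \<rho> (Var x) = \<rho> x"
| "eval H \<rho> (App f ts) = opn H f (map (eval H \<rho>) ts)"

fun wf_trm :: "('f \<Rightarrow> nat) \<Rightarrow> ('f, 'v) trm \<Rightarrow> bool" where
  "wf_trm ar (Var x) = True"
| "wf_trm ar (App f ts) = (length ts = ar f \<and> (\<forall>t\<in>set ts. wf_trm ar t))"

definition Trm :: "('f \<Rightarrow> nat) \<Rightarrow> 'v set \<Rightarrow> ('f, 'v) trm set" where
  "Trm ar X = {t. wf_trm ar t \<and> tvars t \<subseteq> X}"

text \<open>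
  Homomorphisms are extensional functions on the carrier, so that two of them are equal as soon
  as they agree on the carrier.
\<close>

definition alg_hom ::
  "('f \<Rightarrow> nat) \<Rightarrow> ('f, 'a) alg \<Rightarrow> ('f, 'b) alg \<Rightarrow> ('a \<Rightarrow> 'b) set" where
  "alg_hom ar A B =
     {h \<in> car A \<rightarrow>\<^sub>E car B.
        \<forall>f as. length as = ar f \<and> set as \<subseteq> car A \<longrightarrow> h (opn A f as) = opn B f (map h as)}"

text \<open>
  Equational consequence: the least fully invariant congruence on terms that contains the
  identities \<open>E\<close>.
\<close>

inductive eqthy ::
  "('f \<Rightarrow> nat) \<Rightarrow> (('f, 'v) trm \<times> ('f, 'v) trm) set \<Rightarrow> ('f, 'v) trm \<Rightarrow> ('f, 'v) trm \<Rightarrow> bool"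
  for ar E where
  ax: "(l, r) \<in> E \<Longrightarrow> (\<And>x. \<sigma> x \<in> Trm ar UNIV) \<Longrightarrow> eqthy ar E (tsubst \<sigma> l) (tsubst \<sigma> r)"
| refl: "t \<in> Trm ar UNIV \<Longrightarrow> eqthy ar E t t"
| sym: "eqthy ar E s t \<Longrightarrow> eqthy ar E t s"
| trans: "eqthy ar E s t \<Longrightarrow> eqthy ar E t u \<Longrightarrow> eqthy ar E s u"
| cong: "length ss = ar f \<Longrightarrow> list_all2 (eqthy ar E) ss ts \<Longrightarrow> eqthy ar E (App f ss) (App f ts)"


section \<open>Formulas and many-sorted structures in the signature of Halmos algebras\<close>

text \<open>
  Sorts are sets \<open>X\<close> of variables, \<open>'w\<close> is the type of elements of the free algebras \<open>W(X)\<close>.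
  For \<open>s : W(X) \<rightarrow> W(Y)\<close>, the operation \<open>hsub A X Y s\<close> is \<open>s\<^sub>*\<close>, from sort \<open>X\<close> to sort \<open>Y\<close>.
\<close>

record ('v, 'w, 'u) halmos =
  hcar :: "'v set \<Rightarrow> 'u set"
  hbot :: "'v set \<Rightarrow> 'u"
  htop :: "'v set \<Rightarrow> 'u"
  hneg :: "'v set \<Rightarrow> 'u \<Rightarrow> 'u"
  hand :: "'v set \<Rightarrow> 'u \<Rightarrow> 'u \<Rightarrow> 'u"
  hor :: "'v set \<Rightarrow> 'u \<Rightarrow> 'u \<Rightarrow> 'u"
  hex :: "'v set \<Rightarrow> 'v \<Rightarrow> 'u \<Rightarrow> 'u"
  heq :: "'v set \<Rightarrow> 'w \<Rightarrow> 'w \<Rightarrow> 'u"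
  hsub :: "'v set \<Rightarrow> 'v set \<Rightarrow> ('w \<Rightarrow> 'w) \<Rightarrow> 'u \<Rightarrow> 'u"

text \<open>
  Terms in this signature.  \<open>HSub X s \<phi>\<close> stands for \<open>s\<^sub>* \<phi>\<close> with \<open>\<phi>\<close> of sort \<open>X\<close>; its own sort
  is given by the context in which it occurs.
\<close>

datatype ('v, 'w) hfm =
    HEq 'w 'w
  | HBot
  | HTop
  | HNeg "('v, 'w) hfm"
  | HAnd "('v, 'w) hfm" "('v, 'w) hfm"
  | HOr "('v, 'w) hfm" "('v, 'w) hfm"
  | HEx 'v "('v, 'w) hfm"
  | HSub "'v set" "'w \<Rightarrow> 'w" "('v, 'w) hfm"

text \<open>The Boolean, quantifier and equality identities concern one sort at a time.\<close>

definition hle :: "('v, 'w, 'u) halmos \<Rightarrow> 'v set \<Rightarrow> 'u \<Rightarrow> 'u \<Rightarrow> bool" where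
  "hle A X a b \<longleftrightarrow> hand A X a b = a"

definition boolean_sort :: "('v, 'w, 'u) halmos \<Rightarrow> 'v set \<Rightarrow> bool" where
  "boolean_sort A X \<longleftrightarrow>
     hbot A X \<in> hcar A X \<and> htop A X \<in> hcar A X \<and>
     (\<forall>a\<in>hcar A X. hneg A X a \<in> hcar A X \<and>
        hand A X a (htop A X) = a \<and> hor A X a (hbot A X) = a \<and>
        hand A X a (hneg A X a) = hbot A X \<and> hor A X a (hneg A X a) = htop A X) \<and>
     (\<forall>a\<in>hcar A X. \<forall>b\<in>hcar A X.
        hand A X a b \<in> hcar A X \<and> hor A X a b \<in> hcar A X \<and>
        hand A X a b = hand A X b a \<and> hor A X a b = hor A X b a) \<and>
     (\<forall>a\<in>hcar A X. \<forall>b\<in>hcar A X. \<forall>c\<in>hcar A X.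
        hand A X a (hand A X b c) = hand A X (hand A X a b) c \<and>
        hor A X a (hor A X b c) = hor A X (hor A X a b) c \<and>
        hand A X a (hor A X b c) = hor A X (hand A X a b) (hand A X a c) \<and>
        hor A X a (hand A X b c) = hand A X (hor A X a b) (hor A X a c))"

definition quantifier_sort :: "('v, 'w, 'u) halmos \<Rightarrow> 'v set \<Rightarrow> bool" where
  "quantifier_sort A X \<longleftrightarrow>
     (\<forall>x\<in>X. hex A X x (hbot A X) = hbot A X \<and>
        (\<forall>a\<in>hcar A X. hex A X x a \<in> hcar A X \<and> hle A X a (hex A X x a)) \<and>
        (\<forall>a\<in>hcar A X. \<forall>b\<in>hcar A X.
           hex A X x (hand A X a (hex A X x b)) = hand A X (hex A X x a) (hex A X x b))) \<and>
     (\<forall>x\<in>X. \<forall>y\<in>X. \<forall>a\<in>hcar A X. hex A X x (hex A X y a) = hex A X y (hex A X x a))"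


section \<open>Logical geometry over a variety\<close>

text \<open>The variety \<open>\<Theta>\<close> is given by a signature \<open>ar\<close> and a set of identities \<open>E\<close>.\<close>

locale variety =
  fixes ar :: "'f \<Rightarrow> nat"
    and E :: "(('f, 'v) trm \<times> ('f, 'v) trm) set"
  assumes identities_wf: "E \<subseteq> Trm ar UNIV \<times> Trm ar UNIV"
    and infinite_vars: "infinite (UNIV :: 'v set)"
begin

text \<open>Membership \<open>H \<in> \<Theta>\<close>; algebras have nonempty carriers.\<close>

definition in_variety :: "('f, 'a) alg \<Rightarrow> bool" where
  "in_variety H \<longleftrightarrow>
     car H \<noteq> {} \<and>
     (\<forall>f as. length as = ar f \<and> set as \<subseteq> car H \<longrightarrow> opn H f as \<in> car H) \<and>
     (\<forall>(l, r)\<in>E. \<forall>\<rho>. range \<rho> \<subseteq> car H \<longrightarrow> eval H \<rho> l = eval H \<rho> r)"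

definition tclass :: "'v set \<Rightarrow> ('f, 'v) trm \<Rightarrow> ('f, 'v) trm set" where
  "tclass X t = {t' \<in> Trm ar X. eqthy ar E t t'}"

definition W :: "'v set \<Rightarrow> ('f, ('f, 'v) trm set) alg" where
  "W X = \<lparr> car = tclass X ` Trm ar X,
           opn = \<lambda>f cs. tclass X (App f (map (\<lambda>c. SOME t. t \<in> c) cs)) \<rparr>"

text \<open>The generator of \<open>W(X)\<close> given by the variable \<open>x \<in> X\<close>.\<close>

definition gen :: "'v set \<Rightarrow> 'v \<Rightarrow> ('f, 'v) trm set" where
  "gen X x = tclass X (Var x)"

definition Hom :: "'v set \<Rightarrow> ('f, 'a) alg \<Rightarrow> (('f, 'v) trm set \<Rightarrow> 'a) set" where
  "Hom X H = alg_hom ar (W X) H"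

definition sorts :: "'v set set" where
  "sorts = {X. finite X} \<union> {UNIV}"

text \<open>The support of \<open>w \<in> W(Y)\<close> omits \<open>y\<close> iff \<open>w\<close> has an expression in which \<open>y\<close> does not occur.\<close>

definition not_in_support :: "'v set \<Rightarrow> 'v \<Rightarrow> ('f, 'v) trm set \<Rightarrow> bool" where
  "not_in_support Y y w \<longleftrightarrow> (\<exists>t\<in>Trm ar (Y - {y}). w = tclass Y t)"


subsection \<open>Halmos algebras\<close>

definition equality_sort :: "('v, ('f, 'v) trm set, 'u) halmos \<Rightarrow> 'v set \<Rightarrow> bool" where
  "equality_sort A X \<longleftrightarrow>
     (\<forall>w\<in>car (W X). heq A X w w = htop A X) \<and>
     (\<forall>w\<in>car (W X). \<forall>w'\<in>car (W X).
        heq A X w w' \<in> hcar A X \<and> heq A X w w' = heq A X w' w) \<and>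
     (\<forall>w\<in>car (W X). \<forall>w'\<in>car (W X). \<forall>w''\<in>car (W X).
        hle A X (hand A X (heq A X w w') (heq A X w' w'')) (heq A X w w'')) \<and>
     (\<forall>f ws ws'. length ws = ar f \<and> length ws' = ar f \<and>
        set ws \<subseteq> car (W X) \<and> set ws' \<subseteq> car (W X) \<longrightarrow>
        hle A X (foldr (hand A X) (map2 (heq A X) ws ws') (htop A X))
                (heq A X (opn (W X) f ws) (opn (W X) f ws')))"

definition substitution_hom :: "('v, ('f, 'v) trm set, 'u) halmos \<Rightarrow> bool" where
  "substitution_hom A \<longleftrightarrow>
     (\<forall>X\<in>sorts. \<forall>Y\<in>sorts. \<forall>s\<in>Hom X (W Y).
        hsub A X Y s (hbot A X) = hbot A Y \<and> hsub A X Y s (htop A X) = htop A Y \<and>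
        (\<forall>a\<in>hcar A X. hsub A X Y s a \<in> hcar A Y \<and>
           hsub A X Y s (hneg A X a) = hneg A Y (hsub A X Y s a)) \<and>
        (\<forall>a\<in>hcar A X. \<forall>b\<in>hcar A X.
           hsub A X Y s (hand A X a b) = hand A Y (hsub A X Y s a) (hsub A X Y s b) \<and>
           hsub A X Y s (hor A X a b) = hor A Y (hsub A X Y s a) (hsub A X Y s b))) \<and>
     (\<forall>X\<in>sorts. \<forall>a\<in>hcar A X. hsub A X X (restrict id (car (W X))) a = a) \<and>
     (\<forall>X\<in>sorts. \<forall>Y\<in>sorts. \<forall>Z\<in>sorts. \<forall>s\<in>Hom X (W Y). \<forall>s'\<in>Hom Y (W Z). \<forall>a\<in>hcar A X.
        hsub A Y Z s' (hsub A X Y s a) = hsub A X Z (compose (car (W X)) s' s) a)"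

definition substitution_quantifier :: "('v, ('f, 'v) trm set, 'u) halmos \<Rightarrow> bool" where
  "substitution_quantifier A \<longleftrightarrow>
     (\<forall>X\<in>sorts. \<forall>Y\<in>sorts. \<forall>s1\<in>Hom X (W Y). \<forall>s2\<in>Hom X (W Y). \<forall>x\<in>X. \<forall>a\<in>hcar A X.
        (\<forall>y\<in>X - {x}. s1 (gen X y) = s2 (gen X y)) \<longrightarrow>
        hsub A X Y s1 (hex A X x a) = hsub A X Y s2 (hex A X x a)) \<and>
     (\<forall>X\<in>sorts. \<forall>Y\<in>sorts. \<forall>s\<in>Hom X (W Y). \<forall>x\<in>X. \<forall>y\<in>Y. \<forall>a\<in>hcar A X.
        s (gen X x) = gen Y y \<and> (\<forall>x'\<in>X - {x}. not_in_support Y y (s (gen X x'))) \<longrightarrow>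
        hsub A X Y s (hex A X x a) = hex A Y y (hsub A X Y s a))"

definition substitution_equality :: "('v, ('f, 'v) trm set, 'u) halmos \<Rightarrow> bool" where
  "substitution_equality A \<longleftrightarrow>
     (\<forall>X\<in>sorts. \<forall>Y\<in>sorts. \<forall>s\<in>Hom X (W Y). \<forall>w\<in>car (W X). \<forall>w'\<in>car (W X).
        hsub A X Y s (heq A X w w') = heq A Y (s w) (s w')) \<and>
     (\<forall>X\<in>sorts. \<forall>s\<in>Hom X (W X). \<forall>s'\<in>Hom X (W X). \<forall>x\<in>X. \<forall>a\<in>hcar A X.
        (\<forall>y\<in>X - {x}. s (gen X y) = gen X y \<and> s' (gen X y) = gen X y) \<longrightarrow>
        hle A X (hand A X (hsub A X X s a) (heq A X (s (gen X x)) (s' (gen X x))))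
                (hsub A X X s' a))"

definition halmos_algebra :: "('v, ('f, 'v) trm set, 'u) halmos \<Rightarrow> bool" where
  "halmos_algebra A \<longleftrightarrow>
     (\<forall>X\<in>sorts. boolean_sort A X \<and> quantifier_sort A X \<and> equality_sort A X) \<and>
     substitution_hom A \<and> substitution_quantifier A \<and> substitution_equality A"

definition halmos_hom ::
  "('v, ('f, 'v) trm set, 'u) halmos \<Rightarrow> ('v, ('f, 'v) trm set, 't) halmos \<Rightarrow>
   ('v set \<Rightarrow> 'u \<Rightarrow> 't) \<Rightarrow> bool" where
  "halmos_hom A B F \<longleftrightarrow>
     (\<forall>X\<in>sorts.
        F X \<in> hcar A X \<rightarrow> hcar B X \<and>
        F X (hbot A X) = hbot B X \<and> F X (htop A X) = htop B X \<and>
        (\<forall>a\<in>hcar A X. F X (hneg A X a) = hneg B X (F X a)) \<and>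
        (\<forall>a\<in>hcar A X. \<forall>b\<in>hcar A X.
           F X (hand A X a b) = hand B X (F X a) (F X b) \<and>
           F X (hor A X a b) = hor B X (F X a) (F X b)) \<and>
        (\<forall>x\<in>X. \<forall>a\<in>hcar A X. F X (hex A X x a) = hex B X x (F X a)) \<and>
        (\<forall>w\<in>car (W X). \<forall>w'\<in>car (W X). F X (heq A X w w') = heq B X w w')) \<and>
     (\<forall>X\<in>sorts. \<forall>Y\<in>sorts. \<forall>s\<in>Hom X (W Y). \<forall>a\<in>hcar A X.
        F Y (hsub A X Y s a) = hsub B X Y s (F X a))"

definition Hal ::
  "('f, 'a) alg \<Rightarrow> ('v, ('f, 'v) trm set, (('f, 'v) trm set \<Rightarrow> 'a) set) halmos" where
  "Hal H = \<lparr>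
     hcar = \<lambda>X. Pow (Hom X H),
     hbot = \<lambda>X. {},
     htop = \<lambda>X. Hom X H,
     hneg = \<lambda>X A. Hom X H - A,
     hand = \<lambda>X A B. A \<inter> B,
     hor = \<lambda>X A B. A \<union> B,
     hex = \<lambda>X x A. {\<mu> \<in> Hom X H. \<exists>\<nu>\<in>A. \<forall>y\<in>X - {x}. \<nu> (gen X y) = \<mu> (gen X y)},
     heq = \<lambda>X w w'. {\<mu> \<in> Hom X H. \<mu> w = \<mu> w'},
     hsub = \<lambda>X Y s A. {\<mu> \<in> Hom Y H. compose (car (W X)) \<mu> s \<in> A} \<rparr>"


subsection \<open>The algebra of formulas\<close>

fun well_sorted :: "'v set \<Rightarrow> ('v, ('f, 'v) trm set) hfm \<Rightarrow> bool" where
  "well_sorted X (HEq w w') = (w \<in> car (W X) \<and> w' \<in> car (W X))"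
| "well_sorted X HBot = True"
| "well_sorted X HTop = True"
| "well_sorted X (HNeg \<phi>) = well_sorted X \<phi>"
| "well_sorted X (HAnd \<phi> \<psi>) = (well_sorted X \<phi> \<and> well_sorted X \<psi>)"
| "well_sorted X (HOr \<phi> \<psi>) = (well_sorted X \<phi> \<and> well_sorted X \<psi>)"
| "well_sorted X (HEx x \<phi>) = (x \<in> X \<and> well_sorted X \<phi>)"
| "well_sorted X (HSub Y s \<phi>) = (Y \<in> sorts \<and> s \<in> Hom Y (W X) \<and> well_sorted Y \<phi>)"

definition Fm :: "'v set \<Rightarrow> ('v, ('f, 'v) trm set) hfm set" where
  "Fm X = {\<phi>. well_sorted X \<phi>}"

definition fm_congruence ::
  "('v set \<Rightarrow> (('v, ('f, 'v) trm set) hfm \<times> ('v, ('f, 'v) trm set) hfm) set) \<Rightarrow> bool" where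
  "fm_congruence R \<longleftrightarrow>
     (\<forall>X\<in>sorts. equiv (Fm X) (R X) \<and>
        (\<forall>(\<phi>, \<phi>')\<in>R X. (HNeg \<phi>, HNeg \<phi>') \<in> R X) \<and>
        (\<forall>(\<phi>, \<phi>')\<in>R X. \<forall>(\<psi>, \<psi>')\<in>R X.
           (HAnd \<phi> \<psi>, HAnd \<phi>' \<psi>') \<in> R X \<and> (HOr \<phi> \<psi>, HOr \<phi>' \<psi>') \<in> R X) \<and>
        (\<forall>x\<in>X. \<forall>(\<phi>, \<phi>')\<in>R X. (HEx x \<phi>, HEx x \<phi>') \<in> R X)) \<and>
     (\<forall>X\<in>sorts. \<forall>Y\<in>sorts. \<forall>s\<in>Hom X (W Y). \<forall>(\<phi>, \<phi>')\<in>R X.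
        (HSub X s \<phi>, HSub X s \<phi>') \<in> R Y)"

definition fm_quotient ::
  "('v set \<Rightarrow> (('v, ('f, 'v) trm set) hfm \<times> ('v, ('f, 'v) trm set) hfm) set) \<Rightarrow>
   ('v, ('f, 'v) trm set, ('v, ('f, 'v) trm set) hfm set) halmos" where
  "fm_quotient R = \<lparr>
     hcar = \<lambda>X. Fm X // R X,
     hbot = \<lambda>X. R X `` {HBot},
     htop = \<lambda>X. R X `` {HTop},
     hneg = \<lambda>X a. \<Union>\<phi>\<in>a. R X `` {HNeg \<phi>},
     hand = \<lambda>X a b. \<Union>\<phi>\<in>a. \<Union>\<psi>\<in>b. R X `` {HAnd \<phi> \<psi>},
     hor = \<lambda>X a b. \<Union>\<phi>\<in>a. \<Union>\<psi>\<in>b. R X `` {HOr \<phi> \<psi>},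
     hex = \<lambda>X x a. \<Union>\<phi>\<in>a. R X `` {HEx x \<phi>},
     heq = \<lambda>X w w'. R X `` {HEq w w'},
     hsub = \<lambda>X Y s a. \<Union>\<phi>\<in>a. R Y `` {HSub X s \<phi>} \<rparr>"

text \<open>
  \<open>\<Phi>\<close> is the absolutely free algebra generated by the formal equalities modulo the least
  congruence whose quotient is a Halmos algebra.
\<close>

definition halmos_cong ::
  "'v set \<Rightarrow> (('v, ('f, 'v) trm set) hfm \<times> ('v, ('f, 'v) trm set) hfm) set" where
  "halmos_cong X = {(\<phi>, \<psi>). \<phi> \<in> Fm X \<and> \<psi> \<in> Fm X \<and>
     (\<forall>R. fm_congruence R \<and> halmos_algebra (fm_quotient R) \<longrightarrow> (\<phi>, \<psi>) \<in> R X)}"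

definition Phi :: "('v, ('f, 'v) trm set, ('v, ('f, 'v) trm set) hfm set) halmos" where
  "Phi = fm_quotient halmos_cong"

text \<open>
  The homomorphism \<open>\<Phi> \<rightarrow> Hal(H)\<close> exists and is uniquely determined on the carriers; preservation
  of \<open>heq\<close> says that \<open>w \<equiv> w'\<close> is sent to \<open>[w \<equiv> w']\<^sub>H\<close>.
\<close>

definition Val ::
  "('f, 'a) alg \<Rightarrow> 'v set \<Rightarrow> ('v, ('f, 'v) trm set) hfm set \<Rightarrow> (('f, 'v) trm set \<Rightarrow> 'a) set" where
  "Val H = (SOME F. halmos_hom Phi (Hal H) F)"

definition LKer ::
  "('f, 'a) alg \<Rightarrow> 'v set \<Rightarrow> (('f, 'v) trm set \<Rightarrow> 'a) \<Rightarrow> ('v, ('f, 'v) trm set) hfm set set" where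
  "LKer H X \<mu> = {u \<in> hcar Phi X. \<mu> \<in> Val H X u}"

definition LG_definable ::
  "('f, 'a) alg \<Rightarrow> 'v set \<Rightarrow> (('f, 'v) trm set \<Rightarrow> 'a) set \<Rightarrow> bool" where
  "LG_definable H X A \<longleftrightarrow> (\<exists>T\<subseteq>hcar Phi X. A = {\<mu> \<in> Hom X H. T \<subseteq> LKer H X \<mu>})"

end


subsection \<open>Special formulas and types\<close>

text \<open>
  First-order formulas with equality over the variables \<open>X\<^sup>0\<close>.  Free and bound variables are
  properties of such formulas, not of their classes in \<open>\<Phi>(X\<^sup>0)\<close>; an element of \<open>\<Phi>(X\<^sup>0)\<close> is
  \<open>X\<close>-special if some formula representing it is.
\<close>

datatype ('f, 'v) fo =
    FEq "('f, 'v) trm" "('f, 'v) trm"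
  | FNeg "('f, 'v) fo"
  | FAnd "('f, 'v) fo" "('f, 'v) fo"
  | FOr "('f, 'v) fo" "('f, 'v) fo"
  | FEx 'v "('f, 'v) fo"

fun wf_fo :: "('f \<Rightarrow> nat) \<Rightarrow> ('f, 'v) fo \<Rightarrow> bool" where
  "wf_fo ar (FEq t t') = (wf_trm ar t \<and> wf_trm ar t')"
| "wf_fo ar (FNeg p) = wf_fo ar p"
| "wf_fo ar (FAnd p q) = (wf_fo ar p \<and> wf_fo ar q)"
| "wf_fo ar (FOr p q) = (wf_fo ar p \<and> wf_fo ar q)"
| "wf_fo ar (FEx x p) = wf_fo ar p"

fun free_vars :: "('f, 'v) fo \<Rightarrow> 'v set" where
  "free_vars (FEq t t') = tvars t \<union> tvars t'"
| "free_vars (FNeg p) = free_vars p"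
| "free_vars (FAnd p q) = free_vars p \<union> free_vars q"
| "free_vars (FOr p q) = free_vars p \<union> free_vars q"
| "free_vars (FEx x p) = free_vars p - {x}"

fun bound_vars :: "('f, 'v) fo \<Rightarrow> 'v set" where
  "bound_vars (FEq t t') = {}"
| "bound_vars (FNeg p) = bound_vars p"
| "bound_vars (FAnd p q) = bound_vars p \<union> bound_vars q"
| "bound_vars (FOr p q) = bound_vars p \<union> bound_vars q"
| "bound_vars (FEx x p) = insert x (bound_vars p)"

context variety
begin

fun fo_to_hfm :: "('f, 'v) fo \<Rightarrow> ('v, ('f, 'v) trm set) hfm" where
  "fo_to_hfm (FEq t t') = HEq (tclass UNIV t) (tclass UNIV t')"
| "fo_to_hfm (FNeg p) = HNeg (fo_to_hfm p)"
| "fo_to_hfm (FAnd p q) = HAnd (fo_to_hfm p) (fo_to_hfm q)"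
| "fo_to_hfm (FOr p q) = HOr (fo_to_hfm p) (fo_to_hfm q)"
| "fo_to_hfm (FEx x p) = HEx x (fo_to_hfm p)"

definition special :: "'v set \<Rightarrow> ('v, ('f, 'v) trm set) hfm set \<Rightarrow> bool" where
  "special X u \<longleftrightarrow>
     (\<exists>p. wf_fo ar p \<and> free_vars p \<subseteq> X \<and> bound_vars p \<subseteq> UNIV - X \<and>
          u = halmos_cong UNIV `` {fo_to_hfm p})"

definition is_type ::
  "('f, 'a) alg \<Rightarrow> 'v set \<Rightarrow> ('v, ('f, 'v) trm set) hfm set set \<Rightarrow> bool" where
  "is_type H X T \<longleftrightarrow>
     T \<subseteq> {u. special X u} \<and>
     (\<forall>S\<subseteq>T. finite S \<longrightarrow> (\<exists>\<eta>\<in>Hom UNIV H. \<forall>u\<in>S. \<eta> \<in> Val H UNIV u))"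

definition Tp ::
  "('f, 'a) alg \<Rightarrow> 'v set \<Rightarrow> (('f, 'v) trm set \<Rightarrow> 'a) \<Rightarrow> ('v, ('f, 'v) trm set) hfm set set" where
  "Tp H X \<mu> = {u. special X u \<and>
     (\<forall>\<eta>\<in>Hom UNIV H. (\<forall>x\<in>X. \<eta> (gen UNIV x) = \<mu> (gen X x)) \<longrightarrow> \<eta> \<in> Val H UNIV u)}"

definition MT_definable ::
  "('f, 'a) alg \<Rightarrow> 'v set \<Rightarrow> (('f, 'v) trm set \<Rightarrow> 'a) set \<Rightarrow> bool" where
  "MT_definable H X A \<longleftrightarrow> (\<exists>T. is_type H X T \<and> A = {\<mu> \<in> Hom X H. T \<subseteq> Tp H X \<mu>})"

end

end

theory Submission
  imports Defs
begin

text \<open>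
  The kernel of the interpretation of formulas in any Halmos algebra is a congruence with a Halmos
  quotient, and \<open>Hal(H)\<close> is a Halmos algebra; hence \<open>Val\<close> is the recursive interpretation in
  \<open>Hal(H)\<close>.  A formula of sort \<open>X\<close> is then equivalent over \<open>H\<close> to a first-order formula with free
  variables in \<open>X\<close>, the substitutions \<open>s\<^sub>*\<close> being executed by capture-avoiding substitution, which
  can also move the bound variables out of \<open>X\<close>.  Conversely an \<open>X\<close>-special \<open>u\<close> is brought back to
  sort \<open>X\<close> as \<open>s\<^sub>* u\<close>, where \<open>s : W(X\<^sup>0) \<rightarrow> W(X)\<close> fixes \<open>X\<close> and sends the other variables anywhere.
  A point of a nonempty LG-definable set witnesses consistency of the corresponding type.
\<close>

section \<open>Free algebras of a variety\<close>

text \<open>\<open>Val\<close> is picked by choice among the homomorphisms from a quotient by an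
  intersection of congruences, so nothing about it can be computed until two facts are known: such a
  homomorphism exists, and any two agree on the carriers. Existence is what forces the full check of
  the Halmos axioms in \<open>Hal H\<close>: it places the kernel of the interpretation among the
  intersected congruences. The other obstacle is that a point of sort X has no coordinates outside
  X, whereas special formulas must bind variables outside X and substitutions mix sorts. Both
  difficulties disappear when satisfaction is expressed through total valuations of all variables
  whose values off X are irrelevant; a finite X leaves infinitely many variables for
  renaming.\<close>

lemma eval_cong:
  assumes "\<And>x. x \<in> tvars t \<Longrightarrow> \<rho> x = \<rho>' x"
  shows "eval H \<rho> t = eval H \<rho>' t"
  using assms
proof (induction t)
  case (App f ts)
  have "map (eval H \<rho>) ts = map (eval H \<rho>') ts"
    using App by (intro map_cong refl) auto
  then show ?case
    unfolding eval.simps by (rule arg_cong)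
qed simp

lemma eval_tsubst: "eval H \<rho> (tsubst \<sigma> t) = eval H (\<lambda>x. eval H \<rho> (\<sigma> x)) t"
proof (induction t)
  case (App f ts)
  have "map (eval H \<rho>) (map (tsubst \<sigma>) ts) = map (eval H (\<lambda>x. eval H \<rho> (\<sigma> x))) ts"
    using App by simp
  then show ?case by (simp only: tsubst.simps eval.simps)
qed simp

lemma wf_trm_tsubst:
  "wf_trm ar t \<Longrightarrow> (\<And>x. wf_trm ar (\<sigma> x)) \<Longrightarrow> wf_trm ar (tsubst \<sigma> t)"
  by (induction t) auto

lemma tvars_tsubst: "tvars (tsubst \<sigma> t) = (\<Union>x\<in>tvars t. tvars (\<sigma> x))"
  by (induction t) auto

lemma finite_tvars: "finite (tvars t)"
  by (induction t) auto

lemma App_in_Trm: "App f ts \<in> Trm ar X \<longleftrightarrow> length ts = ar f \<and> set ts \<subseteq> Trm ar X"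
  by (auto simp: Trm_def)

lemma Var_in_Trm: "Var x \<in> Trm ar X \<longleftrightarrow> x \<in> X"
  by (simp add: Trm_def)

lemma Trm_mono: "X \<subseteq> Y \<Longrightarrow> Trm ar X \<subseteq> Trm ar Y"
  by (auto simp: Trm_def)

lemma finite_free_vars: "finite (free_vars p)"
  by (induction p) (auto simp: finite_tvars)

context variety
begin

lemma in_variety_closed:
  "in_variety H \<Longrightarrow> length as = ar f \<Longrightarrow> set as \<subseteq> car H \<Longrightarrow> opn H f as \<in> car H"
  unfolding in_variety_def by blast

lemma eval_in_car:
  assumes "in_variety H" "\<And>x. x \<in> X \<Longrightarrow> \<rho> x \<in> car H" "t \<in> Trm ar X"
  shows "eval H \<rho> t \<in> car H"
  using assms(3)
proof (induction t)
  case (Var x)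
  then show ?case using assms(2) by (simp add: Var_in_Trm)
next
  case (App f ts)
  then have "set (map (eval H \<rho>) ts) \<subseteq> car H" "length ts = ar f"
    by (auto simp: App_in_Trm)
  then show ?case by (simp add: in_variety_closed[OF assms(1)])
qed

text \<open>An instance of an identity under \<open>\<sigma>\<close> is the identity itself under
  the valuation that evaluates \<open>\<sigma> x\<close>. The valuation has to be total in
  \<open>car H\<close>: by transitivity a derivation between terms over X may pass through terms
  with other variables.\<close>

lemma eqthy_sound:
  assumes H: "in_variety H"
  shows "eqthy ar E s t \<Longrightarrow> (\<And>x. \<rho> x \<in> car H) \<Longrightarrow> eval H \<rho> s = eval H \<rho> t"
proof (induction rule: eqthy.induct)
  case (ax l r \<sigma>)
  have "range (\<lambda>x. eval H \<rho> (\<sigma> x)) \<subseteq> car H"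
    using eval_in_car[OF H _ ax(2)] ax(3) by blast
  then show ?case
    using H ax(1) unfolding in_variety_def eval_tsubst by blast
next
  case (cong ss f ts)
  have "map (eval H \<rho>) ss = map (eval H \<rho>) ts"
    using cong.IH cong.prems by (simp add: list_all2_conv_all_nth list_eq_iff_nth_eq)
  then show ?case by simp
qed auto

lemma tclass_eq_iff:
  assumes "s \<in> Trm ar X" "t \<in> Trm ar X"
  shows "tclass X s = tclass X t \<longleftrightarrow> eqthy ar E s t"
proof -
  have "t \<in> tclass X t"
    using assms Trm_mono[of X UNIV] by (auto simp: tclass_def intro: eqthy.refl)
  then show ?thesis
    by (auto simp: tclass_def intro: eqthy.sym eqthy.trans)
qed

lemma tclass_some:
  assumes "t \<in> Trm ar X"
  shows "(SOME t'. t' \<in> tclass X t) \<in> Trm ar X" "eqthy ar E t (SOME t'. t' \<in> tclass X t)"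
proof -
  have "t \<in> tclass X t"
    using assms Trm_mono[of X UNIV] by (auto simp: tclass_def intro: eqthy.refl)
  then have "(SOME t'. t' \<in> tclass X t) \<in> tclass X t" by (rule someI)
  then show "(SOME t'. t' \<in> tclass X t) \<in> Trm ar X" "eqthy ar E t (SOME t'. t' \<in> tclass X t)"
    by (auto simp: tclass_def)
qed

lemma car_W: "car (W X) = tclass X ` Trm ar X"
  by (simp add: W_def)

lemma gen_in_W: "x \<in> X \<Longrightarrow> gen X x \<in> car (W X)"
  by (simp add: gen_def car_W Var_in_Trm)

text \<open>The operations of \<open>W X\<close> act on chosen representatives; the congruence rule
  of \<open>eqthy\<close> makes the resulting class independent of the choice.\<close>

lemma opn_W:
  assumes "length ts = ar f" "set ts \<subseteq> Trm ar X"
  shows "opn (W X) f (map (tclass X) ts) = tclass X (App f ts)"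
proof -
  let ?us = "map (\<lambda>t. SOME t'. t' \<in> tclass X t) ts"
  have "list_all2 (eqthy ar E) ts ?us"
    using assms tclass_some(2) by (auto simp: list_all2_conv_all_nth subset_iff)
  then have "eqthy ar E (App f ts) (App f ?us)"
    using assms by (intro eqthy.cong)
  moreover have "App f ts \<in> Trm ar X" "App f ?us \<in> Trm ar X"
    using assms tclass_some(1) by (auto simp: App_in_Trm)
  ultimately have "tclass X (App f ts) = tclass X (App f ?us)"
    by (simp add: tclass_eq_iff)
  then show ?thesis by (simp add: W_def comp_def)
qed

lemma W_list_cases:
  assumes "set ws \<subseteq> car (W X)"
  obtains ts where "ws = map (tclass X) ts" "set ts \<subseteq> Trm ar X"
proof -
  have "ws \<in> lists (tclass X ` Trm ar X)"
    using assms by (auto simp: car_W)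
  then obtain ts where "ts \<in> lists (Trm ar X)" "ws = map (tclass X) ts"
    by (auto simp: lists_image)
  then show thesis using that by auto
qed

lemma opn_W_closed:
  assumes "length ws = ar f" "set ws \<subseteq> car (W X)"
  shows "opn (W X) f ws \<in> car (W X)"
proof -
  obtain ts where ts: "ws = map (tclass X) ts" "set ts \<subseteq> Trm ar X"
    using W_list_cases[OF assms(2)] .
  then have "App f ts \<in> Trm ar X" using assms by (simp add: App_in_Trm)
  then show ?thesis using ts assms by (simp add: opn_W car_W)
qed

section \<open>Homomorphisms out of free algebras\<close>

lemma Hom_in_car: "\<mu> \<in> Hom X H \<Longrightarrow> w \<in> car (W X) \<Longrightarrow> \<mu> w \<in> car H"
  by (auto simp: Hom_def alg_hom_def)

lemma Hom_opn:
  "\<mu> \<in> Hom X H \<Longrightarrow> length ws = ar f \<Longrightarrow> set ws \<subseteq> car (W X) \<Longrightarrow>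
   \<mu> (opn (W X) f ws) = opn H f (map \<mu> ws)"
  by (auto simp: Hom_def alg_hom_def)

lemma Hom_tclass:
  assumes "\<mu> \<in> Hom X H" "t \<in> Trm ar X"
  shows "\<mu> (tclass X t) = eval H (\<lambda>x. \<mu> (gen X x)) t"
  using assms(2)
proof (induction t)
  case (Var x)
  then show ?case by (simp add: gen_def)
next
  case (App f ts)
  then have ts: "length ts = ar f" "set ts \<subseteq> Trm ar X" by (auto simp: App_in_Trm)
  have "\<mu> (tclass X (App f ts)) = opn H f (map \<mu> (map (tclass X) ts))"
    using ts by (simp only: opn_W[symmetric])
      (intro Hom_opn[OF assms(1)], auto simp: car_W)
  also have "map \<mu> (map (tclass X) ts) = map (eval H (\<lambda>x. \<mu> (gen X x))) ts"
    using App ts by auto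
  finally show ?case by simp
qed

lemma Hom_eqI:
  assumes "\<mu> \<in> Hom X H" "\<nu> \<in> Hom X H" "\<And>x. x \<in> X \<Longrightarrow> \<mu> (gen X x) = \<nu> (gen X x)"
  shows "\<mu> = \<nu>"
proof (rule extensionalityI)
  show "\<mu> \<in> extensional (car (W X))" "\<nu> \<in> extensional (car (W X))"
    using assms by (auto simp: Hom_def alg_hom_def PiE_def)
  fix w assume "w \<in> car (W X)"
  then obtain t where t: "t \<in> Trm ar X" "w = tclass X t" by (auto simp: car_W)
  have "eval H (\<lambda>x. \<mu> (gen X x)) t = eval H (\<lambda>x. \<nu> (gen X x)) t"
    using t(1) assms(3) by (intro eval_cong) (auto simp: Trm_def)
  then show "\<mu> w = \<nu> w"
    using t assms by (simp add: Hom_tclass)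
qed

text \<open>The homomorphism given by freeness. It evaluates a chosen representative, which is
  harmless by soundness once H lies in the variety and the valuation is total; the restriction to
  the carrier makes it extensional, as \<open>Hom\<close> demands.\<close>

definition hom_ext :: "'v set \<Rightarrow> ('f, 'a) alg \<Rightarrow> ('v \<Rightarrow> 'a) \<Rightarrow> ('f, 'v) trm set \<Rightarrow> 'a" where
  "hom_ext X H \<rho> = restrict (\<lambda>c. eval H \<rho> (SOME t. t \<in> c)) (car (W X))"

lemma hom_ext_tclass:
  assumes "in_variety H" "\<And>x. \<rho> x \<in> car H" "t \<in> Trm ar X"
  shows "hom_ext X H \<rho> (tclass X t) = eval H \<rho> t"
  using assms eqthy_sound[OF assms(1) tclass_some(2)[OF assms(3)] assms(2)]
  by (auto simp: hom_ext_def car_W)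

lemma hom_ext_gen:
  assumes "in_variety H" "\<And>x. \<rho> x \<in> car H" "x \<in> X"
  shows "hom_ext X H \<rho> (gen X x) = \<rho> x"
  unfolding gen_def using hom_ext_tclass[OF assms(1,2), of "Var x" X] assms
  by (simp add: Var_in_Trm)

lemma hom_ext_in_Hom:
  assumes "in_variety H" "\<And>x. \<rho> x \<in> car H"
  shows "hom_ext X H \<rho> \<in> Hom X H"
proof -
  note val = hom_ext_tclass[OF assms]
  have "hom_ext X H \<rho> \<in> car (W X) \<rightarrow>\<^sub>E car H"
  proof (rule PiE_I)
    fix w assume "w \<in> car (W X)"
    then show "hom_ext X H \<rho> w \<in> car H"
      using eval_in_car[of H X \<rho>] assms by (auto simp: car_W val)
  qed (simp add: hom_ext_def)
  moreover have "hom_ext X H \<rho> (opn (W X) f ws) = opn H f (map (hom_ext X H \<rho>) ws)"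
    if ws: "length ws = ar f" "set ws \<subseteq> car (W X)" for f ws
  proof -
    obtain ts where ts: "ws = map (tclass X) ts" "set ts \<subseteq> Trm ar X"
      using W_list_cases[OF ws(2)] .
    then have "App f ts \<in> Trm ar X" using ws by (simp add: App_in_Trm)
    moreover have "map (hom_ext X H \<rho>) ws = map (eval H \<rho>) ts"
      using ts by (auto simp: val)
    ultimately show ?thesis
      using ts ws opn_W[of ts f X] val[of "App f ts" X] by (simp del: map_map)
  qed
  ultimately show ?thesis by (auto simp: Hom_def alg_hom_def)
qed

text \<open>Freeness in the form that quantifiers need: the value of a point at one generator can be
  changed at will, the others being kept.\<close>

lemma Hom_update:
  assumes "in_variety H" "\<mu> \<in> Hom X H" "v \<in> car H"
  obtains \<mu>' where "\<mu>' \<in> Hom X H" "y \<in> X \<Longrightarrow> \<mu>' (gen X y) = v"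
    "\<And>x. x \<in> X \<Longrightarrow> x \<noteq> y \<Longrightarrow> \<mu>' (gen X x) = \<mu> (gen X x)"
proof -
  \<comment> \<open>Outside X, where \<open>\<mu>\<close> prescribes nothing, v doubles as the
    default value that makes the valuation total.\<close>
  let ?\<rho> = "\<lambda>x. if x = y \<or> x \<notin> X then v else \<mu> (gen X x)"
  have \<rho>: "?\<rho> x \<in> car H" for x
    using assms gen_in_W by (auto intro: Hom_in_car)
  show thesis
    using hom_ext_in_Hom[OF assms(1), of ?\<rho>] hom_ext_gen[OF assms(1), of ?\<rho>] \<rho>
    by (intro that[of "hom_ext X H ?\<rho>"]) auto
qed

lemma compose_in_Hom:
  assumes "s \<in> Hom X (W Y)" "\<mu> \<in> Hom Y H"
  shows "compose (car (W X)) \<mu> s \<in> Hom X H"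
proof -
  have "compose (car (W X)) \<mu> s (opn (W X) f ws) = opn H f (map (compose (car (W X)) \<mu> s) ws)"
    if "length ws = ar f" "set ws \<subseteq> car (W X)" for f ws
  proof -
    have "set (map s ws) \<subseteq> car (W Y)"
      using that assms(1) by (auto intro: Hom_in_car)
    moreover have "map (compose (car (W X)) \<mu> s) ws = map \<mu> (map s ws)"
      using that by (auto simp: compose_def)
    ultimately show ?thesis
      using that assms Hom_opn[of \<mu> Y H "map s ws" f] Hom_opn[of s X "W Y" ws f]
      by (simp del: map_map add: compose_eq opn_W_closed)
  qed
  then show ?thesis
    using assms by (auto simp: Hom_def alg_hom_def compose_def)
qed

lemma eval_W:
  assumes "\<And>x. \<sigma> x \<in> Trm ar X" "wf_trm ar t"
  shows "eval (W X) (\<lambda>x. tclass X (\<sigma> x)) t = tclass X (tsubst \<sigma> t)"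
  using assms(2)
proof (induction t)
  case (App f ts)
  have "set (map (tsubst \<sigma>) ts) \<subseteq> Trm ar X"
    using App.prems assms(1) by (fastforce simp: Trm_def tvars_tsubst intro!: wf_trm_tsubst)
  moreover have "map (eval (W X) (\<lambda>x. tclass X (\<sigma> x))) ts = map (tclass X) (map (tsubst \<sigma>) ts)"
    using App by auto
  ultimately show ?case
    using App.prems opn_W[of "map (tsubst \<sigma>) ts" f X]
    by (simp only: tsubst.simps eval.simps wf_trm.simps length_map)
qed simp

text \<open>Makes \<open>W X\<close> an admissible target for homomorphisms defined on generators. A
  generator is what guarantees a nonempty carrier: without constants \<open>W {}\<close> is
  empty.\<close>

lemma in_variety_W:
  assumes "X \<noteq> {}"
  shows "in_variety (W X)"
proof -
  have "car (W X) \<noteq> {}"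
    using assms gen_in_W by blast
  moreover have "eval (W X) \<rho> l = eval (W X) \<rho> r"
    if lr: "(l, r) \<in> E" and \<rho>: "range \<rho> \<subseteq> car (W X)" for l r \<rho>
  proof -
    have "\<forall>x. \<exists>t. t \<in> Trm ar X \<and> \<rho> x = tclass X t"
      using \<rho> by (auto simp: car_W)
    then obtain \<sigma> where \<sigma>: "\<And>x. \<sigma> x \<in> Trm ar X" "\<And>x. \<rho> x = tclass X (\<sigma> x)"
      by metis
    have wf: "wf_trm ar l" "wf_trm ar r"
      using lr identities_wf by (auto simp: Trm_def)
    \<comment> \<open>Representatives \<open>\<sigma>\<close> of the values turn a valuation in
      \<open>W X\<close> into a substitution, and \<open>eqthy\<close> contains all substitution
      instances of the identities.\<close>
    have "eqthy ar E (tsubst \<sigma> l) (tsubst \<sigma> r)"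
      using lr \<sigma>(1) Trm_mono[of X UNIV] by (intro eqthy.ax) auto
    moreover have "tsubst \<sigma> l \<in> Trm ar X" "tsubst \<sigma> r \<in> Trm ar X"
      using wf \<sigma>(1) by (fastforce simp: Trm_def tvars_tsubst intro!: wf_trm_tsubst)+
    ultimately have "tclass X (tsubst \<sigma> l) = tclass X (tsubst \<sigma> r)"
      by (simp add: tclass_eq_iff)
    moreover have "\<rho> = (\<lambda>x. tclass X (\<sigma> x))" using \<sigma>(2) by auto
    ultimately show ?thesis using wf \<sigma>(1) by (simp add: eval_W)
  qed
  ultimately show ?thesis
    using opn_W_closed unfolding in_variety_def by auto
qed


section \<open>The algebra of subsets of \<open>Hom(W(X), H)\<close>\<close>

lemma Hal_simps [simp]:
  "hcar (Hal H) X = Pow (Hom X H)"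
  "hbot (Hal H) X = {}"
  "htop (Hal H) X = Hom X H"
  "hneg (Hal H) X a = Hom X H - a"
  "hand (Hal H) X a b = a \<inter> b"
  "hor (Hal H) X a b = a \<union> b"
  "hex (Hal H) X x a = {\<mu> \<in> Hom X H. \<exists>\<nu>\<in>a. \<forall>y\<in>X - {x}. \<nu> (gen X y) = \<mu> (gen X y)}"
  "heq (Hal H) X w w' = {\<mu> \<in> Hom X H. \<mu> w = \<mu> w'}"
  "hsub (Hal H) X Y s a = {\<mu> \<in> Hom Y H. compose (car (W X)) \<mu> s \<in> a}"
  by (simp_all add: Hal_def)

lemma hex_HalI:
  assumes "\<mu> \<in> Hom X H" "\<nu> \<in> a" "\<And>z. z \<in> X - {x} \<Longrightarrow> \<nu> (gen X z) = \<mu> (gen X z)"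
  shows "\<mu> \<in> hex (Hal H) X x a"
  using assms by auto

lemma hle_Hal: "hle (Hal H) X a b \<longleftrightarrow> a \<subseteq> b"
  by (auto simp: hle_def)

lemma boolean_sort_Hal: "boolean_sort (Hal H) X"
  unfolding boolean_sort_def by auto

lemma quantifier_sort_Hal:
  assumes H: "in_variety H"
  shows "quantifier_sort (Hal H) X"
proof -
  have comm: "hex (Hal H) X x (hex (Hal H) X y a) \<subseteq> hex (Hal H) X y (hex (Hal H) X x a)"
    if xy: "x \<in> X" "y \<in> X" and a: "a \<subseteq> Hom X H" for x y a
  proof
    fix \<mu> assume "\<mu> \<in> hex (Hal H) X x (hex (Hal H) X y a)"
    then obtain \<nu> \<nu>' where \<mu>: "\<mu> \<in> Hom X H" and \<nu>: "\<nu> \<in> Hom X H" "\<nu>' \<in> a"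
      and eq: "\<And>z. z \<in> X - {x} \<Longrightarrow> \<nu> (gen X z) = \<mu> (gen X z)"
        "\<And>z. z \<in> X - {y} \<Longrightarrow> \<nu>' (gen X z) = \<nu> (gen X z)"
      by auto
    \<comment> \<open>The two moves are made in the other order: \<open>\<mu>'\<close> is
      \<open>\<mu>\<close> with the value of \<open>\<nu>'\<close> at y, so it differs from
      \<open>\<mu>\<close> only at y and from \<open>\<nu>'\<close> only at x.\<close>
    have "\<nu>' (gen X y) \<in> car H"
      using \<nu> a gen_in_W[OF xy(2)] by (auto intro: Hom_in_car)
    then obtain \<mu>' where \<mu>': "\<mu>' \<in> Hom X H" "\<mu>' (gen X y) = \<nu>' (gen X y)"
      "\<And>z. z \<in> X \<Longrightarrow> z \<noteq> y \<Longrightarrow> \<mu>' (gen X z) = \<mu> (gen X z)"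
      using Hom_update[OF H \<mu>] xy(2) by metis
    have "\<nu>' (gen X z) = \<mu>' (gen X z)" if "z \<in> X - {x}" for z
      using that eq \<mu>'(2,3) by (cases "z = y") auto
    then have "\<mu>' \<in> hex (Hal H) X x a"
      using \<mu>'(1) \<nu>(2) by auto
    then show "\<mu> \<in> hex (Hal H) X y (hex (Hal H) X x a)"
      using \<mu> \<mu>'(3) by auto
  qed
  have "hex (Hal H) X x (hex (Hal H) X y a) = hex (Hal H) X y (hex (Hal H) X x a)"
    if "x \<in> X" "y \<in> X" "a \<in> hcar (Hal H) X" for x y a
    using comm that by (metis Hal_simps(1) PowD subset_antisym)
  moreover have "hex (Hal H) X x (hand (Hal H) X a (hex (Hal H) X x b)) =
      hand (Hal H) X (hex (Hal H) X x a) (hex (Hal H) X x b)"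
    if "a \<in> hcar (Hal H) X" for x a b
  proof
    show "hand (Hal H) X (hex (Hal H) X x a) (hex (Hal H) X x b)
        \<subseteq> hex (Hal H) X x (hand (Hal H) X a (hex (Hal H) X x b))"
    proof
      fix \<mu> assume "\<mu> \<in> hand (Hal H) X (hex (Hal H) X x a) (hex (Hal H) X x b)"
      then obtain \<nu> \<nu>' where \<nu>: "\<mu> \<in> Hom X H" "\<nu> \<in> a" "\<nu>' \<in> b"
        "\<And>z. z \<in> X - {x} \<Longrightarrow> \<nu> (gen X z) = \<mu> (gen X z)"
        "\<And>z. z \<in> X - {x} \<Longrightarrow> \<nu>' (gen X z) = \<mu> (gen X z)"
        by auto
      then have "\<nu> \<in> a \<inter> hex (Hal H) X x b"
        using that by auto
      then show "\<mu> \<in> hex (Hal H) X x (hand (Hal H) X a (hex (Hal H) X x b))"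
        unfolding Hal_simps(5) by (intro hex_HalI[OF \<nu>(1) _ \<nu>(4)])
    qed
  next
    show "hex (Hal H) X x (hand (Hal H) X a (hex (Hal H) X x b))
        \<subseteq> hand (Hal H) X (hex (Hal H) X x a) (hex (Hal H) X x b)"
    proof
      fix \<mu> assume "\<mu> \<in> hex (Hal H) X x (hand (Hal H) X a (hex (Hal H) X x b))"
      then obtain \<nu> \<nu>' where \<nu>: "\<mu> \<in> Hom X H" "\<nu> \<in> a" "\<nu>' \<in> b"
        "\<And>z. z \<in> X - {x} \<Longrightarrow> \<nu> (gen X z) = \<mu> (gen X z)"
        "\<And>z. z \<in> X - {x} \<Longrightarrow> \<nu>' (gen X z) = \<nu> (gen X z)"
        by auto
      then have "\<forall>z\<in>X - {x}. \<nu>' (gen X z) = \<mu> (gen X z)" by simp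
      then show "\<mu> \<in> hand (Hal H) X (hex (Hal H) X x a) (hex (Hal H) X x b)"
        using \<nu> by auto
    qed
  qed
  moreover have "a \<subseteq> hex (Hal H) X x a" if "a \<in> hcar (Hal H) X" for x a
    using that by auto
  moreover have "hex (Hal H) X x a \<in> hcar (Hal H) X" "hex (Hal H) X x (hbot (Hal H) X) = hbot (Hal H) X"
    for x a
    by auto
  ultimately show ?thesis
    unfolding quantifier_sort_def hle_Hal by (intro conjI ballI) assumption+
qed

lemma equality_sort_Hal: "equality_sort (Hal H) X"
proof -
  \<comment> \<open>The conjunction of coordinatewise equalities consists of the points that
    identify the two argument lists; such points also identify the results of the operation.\<close>
  have meet: "foldr (hand (Hal H) X) (map2 (heq (Hal H) X) ws ws') (htop (Hal H) X)
      = {\<mu> \<in> Hom X H. map \<mu> ws = map \<mu> ws'}" if "length ws = length ws'" for ws ws'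
    using that by (induction ws ws' rule: list_induct2) auto
  have "foldr (hand (Hal H) X) (map2 (heq (Hal H) X) ws ws') (htop (Hal H) X)
      \<subseteq> heq (Hal H) X (opn (W X) f ws) (opn (W X) f ws')"
    if "length ws = ar f \<and> length ws' = ar f \<and> set ws \<subseteq> car (W X) \<and> set ws' \<subseteq> car (W X)"
    for f ws ws'
  proof -
    have "length ws = length ws'" using that by simp
    then show ?thesis
      unfolding meet[OF \<open>length ws = length ws'\<close>] using that by (auto simp: Hom_opn)
  qed
  moreover have "hand (Hal H) X (heq (Hal H) X w w') (heq (Hal H) X w' w'') \<subseteq> heq (Hal H) X w w''"
    "heq (Hal H) X w w \<in> hcar (Hal H) X" "heq (Hal H) X w w = htop (Hal H) X"
    "heq (Hal H) X w w' \<in> hcar (Hal H) X" "heq (Hal H) X w w' = heq (Hal H) X w' w" for w w' w''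
    by auto
  ultimately show ?thesis
    unfolding equality_sort_def hle_Hal
    by (intro conjI ballI allI impI) assumption+
qed

lemma substitution_hom_Hal: "substitution_hom (Hal H)"
proof -
  have "hsub (Hal H) X X (restrict id (car (W X))) a = a" if "a \<in> hcar (Hal H) X" for X a
  proof -
    have "compose (car (W X)) \<mu> (restrict id (car (W X))) = \<mu>" if "\<mu> \<in> Hom X H" for \<mu>
      using that by (auto simp: Hom_def alg_hom_def compose_def PiE_def extensional_def fun_eq_iff)
    then show ?thesis using that by auto
  qed
  moreover have "hsub (Hal H) Y Z s' (hsub (Hal H) X Y s a)
      = hsub (Hal H) X Z (compose (car (W X)) s' s) a"
    if s: "s \<in> Hom X (W Y)" "s' \<in> Hom Y (W Z)" for X Y Z s s' a
  proof -
    have "compose (car (W X)) (compose (car (W Y)) \<mu> s') s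
        = compose (car (W X)) \<mu> (compose (car (W X)) s' s)" for \<mu> :: "_ \<Rightarrow> 'a"
      using s Hom_in_car[OF s(1)] by (auto simp: compose_def fun_eq_iff)
    then show ?thesis using compose_in_Hom[OF s(2)] by auto
  qed
  moreover have "hsub (Hal H) X Y s (hneg (Hal H) X a) = hneg (Hal H) Y (hsub (Hal H) X Y s a)"
    "hsub (Hal H) X Y s (htop (Hal H) X) = htop (Hal H) Y" if "s \<in> Hom X (W Y)" for X Y s a
    using compose_in_Hom[OF that] by auto
  moreover have "hsub (Hal H) X Y s (hbot (Hal H) X) = hbot (Hal H) Y"
    "hsub (Hal H) X Y s a \<in> hcar (Hal H) Y"
    "hsub (Hal H) X Y s (hand (Hal H) X a b) =
      hand (Hal H) Y (hsub (Hal H) X Y s a) (hsub (Hal H) X Y s b)"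
    "hsub (Hal H) X Y s (hor (Hal H) X a b) =
      hor (Hal H) Y (hsub (Hal H) X Y s a) (hsub (Hal H) X Y s b)" for X Y s a b
    by auto
  ultimately show ?thesis
    unfolding substitution_hom_def by (intro conjI ballI) assumption+
qed

lemma substitution_quantifier_Hal:
  assumes H: "in_variety H"
  shows "substitution_quantifier (Hal H)"
proof -
  have "hsub (Hal H) X Y s (hex (Hal H) X x a) = hex (Hal H) Y y (hsub (Hal H) X Y s a)"
    if s: "s \<in> Hom X (W Y)" and x: "x \<in> X" and y: "y \<in> Y" and a: "a \<in> hcar (Hal H) X"
      and sx: "s (gen X x) = gen Y y \<and> (\<forall>x'\<in>X - {x}. not_in_support Y y (s (gen X x')))"
    for X Y s x y a
  proof -
    have comp: "compose (car (W X)) \<mu> s (gen X z) = \<mu> (s (gen X z))" if "z \<in> X" for \<mu> :: "_ \<Rightarrow> 'a" and z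
      using gen_in_W[OF that] by (simp add: compose_eq)
    \<comment> \<open>This is where the support condition acts: a representative term without y
      takes the same value at points that agree off y.\<close>
    have indep: "\<mu> (s (gen X z)) = \<mu>' (s (gen X z))"
      if z: "z \<in> X - {x}" and \<mu>: "\<mu> \<in> Hom Y H" "\<mu>' \<in> Hom Y H"
        and eq: "\<And>v. v \<in> Y - {y} \<Longrightarrow> \<mu> (gen Y v) = \<mu>' (gen Y v)" for z \<mu> \<mu>'
    proof -
      obtain t where t: "t \<in> Trm ar (Y - {y})" "s (gen X z) = tclass Y t"
        using sx z unfolding not_in_support_def by blast
      then have "t \<in> Trm ar Y" using Trm_mono[of "Y - {y}" Y] by auto
      then show ?thesis
        using t eq \<mu> by (auto simp: Hom_tclass Trm_def intro!: eval_cong)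
    qed
    show ?thesis
    proof (intro subset_antisym subsetI)
      fix \<mu> assume "\<mu> \<in> hsub (Hal H) X Y s (hex (Hal H) X x a)"
      then obtain \<nu> where \<mu>: "\<mu> \<in> Hom Y H" and \<nu>: "\<nu> \<in> a"
        and eq: "\<And>z. z \<in> X - {x} \<Longrightarrow> \<nu> (gen X z) = \<mu> (s (gen X z))"
        using comp by auto
      have \<nu>': "\<nu> \<in> Hom X H" using \<nu> a by auto
      \<comment> \<open>Giving y the value that \<open>\<nu>\<close> has at x makes the composite of
        \<open>\<mu>'\<close> with s equal to \<open>\<nu>\<close>: at x because s sends this
        generator to that of y, elsewhere by \<open>indep\<close>.\<close>
      then obtain \<mu>' where \<mu>': "\<mu>' \<in> Hom Y H" "\<mu>' (gen Y y) = \<nu> (gen X x)"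
        "\<And>z. z \<in> Y \<Longrightarrow> z \<noteq> y \<Longrightarrow> \<mu>' (gen Y z) = \<mu> (gen Y z)"
        using Hom_update[OF H \<mu> Hom_in_car[OF \<nu>' gen_in_W[OF x]]] y by metis
      have "compose (car (W X)) \<mu>' s = \<nu>"
      proof (rule Hom_eqI[OF compose_in_Hom[OF s \<mu>'(1)] \<nu>'])
        fix z assume z: "z \<in> X"
        show "compose (car (W X)) \<mu>' s (gen X z) = \<nu> (gen X z)"
        proof (cases "z = x")
          case True
          then show ?thesis using comp x sx \<mu>'(2) by simp
        next
          case False
          then show ?thesis
            using comp[OF z] eq[of z] z indep[of z \<mu>' \<mu>] \<mu> \<mu>' by simp
        qed
      qed
      then show "\<mu> \<in> hex (Hal H) Y y (hsub (Hal H) X Y s a)"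
        using \<mu> \<mu>' \<nu> by auto
    next
      fix \<mu> assume "\<mu> \<in> hex (Hal H) Y y (hsub (Hal H) X Y s a)"
      then obtain \<mu>' where \<mu>: "\<mu> \<in> Hom Y H" "\<mu>' \<in> Hom Y H" "compose (car (W X)) \<mu>' s \<in> a"
        and eq: "\<And>z. z \<in> Y - {y} \<Longrightarrow> \<mu>' (gen Y z) = \<mu> (gen Y z)"
        by auto
      have "compose (car (W X)) \<mu>' s (gen X z) = compose (car (W X)) \<mu> s (gen X z)" if "z \<in> X - {x}" for z
        using that comp indep[OF that \<mu>(2,1) eq] by simp
      then show "\<mu> \<in> hsub (Hal H) X Y s (hex (Hal H) X x a)"
        using \<mu> compose_in_Hom[OF s \<mu>(1)] by auto
    qed
  qed
  moreover have "hsub (Hal H) X Y s1 (hex (Hal H) X x a) = hsub (Hal H) X Y s2 (hex (Hal H) X x a)"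
    if s: "s1 \<in> Hom X (W Y)" "s2 \<in> Hom X (W Y)"
      and eq: "\<forall>y\<in>X - {x}. s1 (gen X y) = s2 (gen X y)" for X Y s1 s2 x a
  proof -
    have "compose (car (W X)) \<mu> s1 (gen X z) = compose (car (W X)) \<mu> s2 (gen X z)"
      if "z \<in> X - {x}" for z and \<mu> :: "_ \<Rightarrow> 'a"
      using that eq gen_in_W[of z X] by (simp add: compose_eq)
    then show ?thesis
      using compose_in_Hom[OF s(1)] compose_in_Hom[OF s(2)] by auto
  qed
  ultimately show ?thesis
    unfolding substitution_quantifier_def by (intro conjI ballI impI) assumption+
qed

lemma substitution_equality_Hal: "substitution_equality (Hal H)"
proof -
  have "hand (Hal H) X (hsub (Hal H) X X s a) (heq (Hal H) X (s (gen X x)) (s' (gen X x)))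
      \<subseteq> hsub (Hal H) X X s' a"
    if s: "s \<in> Hom X (W X)" "s' \<in> Hom X (W X)"
      and eq: "\<forall>y\<in>X - {x}. s (gen X y) = gen X y \<and> s' (gen X y) = gen X y"
    for X s s' x a
  proof
    fix \<mu>
    assume \<mu>: "\<mu> \<in> hand (Hal H) X (hsub (Hal H) X X s a) (heq (Hal H) X (s (gen X x)) (s' (gen X x)))"
    then have \<mu>': "\<mu> \<in> Hom X H" "\<mu> (s (gen X x)) = \<mu> (s' (gen X x))"
      by auto
    have "compose (car (W X)) \<mu> s = compose (car (W X)) \<mu> s'"
    proof (rule Hom_eqI[OF compose_in_Hom[OF s(1) \<mu>'(1)] compose_in_Hom[OF s(2) \<mu>'(1)]])
      fix z assume z: "z \<in> X"
      then show "compose (car (W X)) \<mu> s (gen X z) = compose (car (W X)) \<mu> s' (gen X z)"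
        using \<mu>'(2) eq gen_in_W[OF z] by (cases "z = x") (auto simp: compose_eq)
    qed
    then show "\<mu> \<in> hsub (Hal H) X X s' a" using \<mu> by simp
  qed
  moreover have "hsub (Hal H) X Y s (heq (Hal H) X w w') = heq (Hal H) Y (s w) (s w')"
    if "s \<in> Hom X (W Y)" "w \<in> car (W X)" "w' \<in> car (W X)" for X Y s w w'
    using that by (auto simp: compose_eq compose_in_Hom)
  ultimately show ?thesis
    unfolding substitution_equality_def hle_Hal
    by (intro conjI ballI impI) assumption+
qed

theorem halmos_algebra_Hal: "in_variety H \<Longrightarrow> halmos_algebra (Hal H)"
  by (simp add: halmos_algebra_def boolean_sort_Hal quantifier_sort_Hal equality_sort_Hal
      substitution_hom_Hal substitution_quantifier_Hal substitution_equality_Hal)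


section \<open>Freeness of the algebra of formulas\<close>

fun hinterp :: "('v, ('f, 'v) trm set, 'u) halmos \<Rightarrow> 'v set \<Rightarrow> ('v, ('f, 'v) trm set) hfm \<Rightarrow> 'u" where
  "hinterp A X (HEq w w') = heq A X w w'"
| "hinterp A X HBot = hbot A X"
| "hinterp A X HTop = htop A X"
| "hinterp A X (HNeg \<phi>) = hneg A X (hinterp A X \<phi>)"
| "hinterp A X (HAnd \<phi> \<psi>) = hand A X (hinterp A X \<phi>) (hinterp A X \<psi>)"
| "hinterp A X (HOr \<phi> \<psi>) = hor A X (hinterp A X \<phi>) (hinterp A X \<psi>)"
| "hinterp A X (HEx x \<phi>) = hex A X x (hinterp A X \<phi>)"
| "hinterp A X (HSub Y s \<phi>) = hsub A Y X s (hinterp A Y \<phi>)"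

lemma Fm_simps [simp]:
  "HEq w w' \<in> Fm X \<longleftrightarrow> w \<in> car (W X) \<and> w' \<in> car (W X)"
  "HBot \<in> Fm X" "HTop \<in> Fm X"
  "HNeg \<phi> \<in> Fm X \<longleftrightarrow> \<phi> \<in> Fm X"
  "HAnd \<phi> \<psi> \<in> Fm X \<longleftrightarrow> \<phi> \<in> Fm X \<and> \<psi> \<in> Fm X"
  "HOr \<phi> \<psi> \<in> Fm X \<longleftrightarrow> \<phi> \<in> Fm X \<and> \<psi> \<in> Fm X"
  "HEx x \<phi> \<in> Fm X \<longleftrightarrow> x \<in> X \<and> \<phi> \<in> Fm X"
  "HSub Y s \<phi> \<in> Fm X \<longleftrightarrow> Y \<in> sorts \<and> s \<in> Hom Y (W X) \<and> \<phi> \<in> Fm Y"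
  by (simp_all add: Fm_def)

lemma hinterp_in_hcar:
  assumes A: "halmos_algebra A"
  shows "X \<in> sorts \<Longrightarrow> \<phi> \<in> Fm X \<Longrightarrow> hinterp A X \<phi> \<in> hcar A X"
proof (induction \<phi> arbitrary: X)
  case (HSub Y s \<phi>)
  then show ?case
    using A unfolding halmos_algebra_def substitution_hom_def by simp
next
  case (HEx x \<phi>)
  then show ?case
    using A unfolding halmos_algebra_def quantifier_sort_def by simp
qed (use A in \<open>simp_all add: halmos_algebra_def boolean_sort_def equality_sort_def\<close>)

lemma id_in_Hom_W: "restrict id (car (W X)) \<in> Hom X (W X)"
proof -
  have "map (restrict id (car (W X))) ws = ws" if "set ws \<subseteq> car (W X)" for ws
    using that by (intro map_idI) auto
  then show ?thesis by (auto simp: Hom_def alg_hom_def opn_W_closed)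
qed

section \<open>Kernels of interpretations and quotients of the algebra of formulas\<close>

definition hker ::
  "('v, ('f, 'v) trm set, 'u) halmos \<Rightarrow>
   'v set \<Rightarrow> (('v, ('f, 'v) trm set) hfm \<times> ('v, ('f, 'v) trm set) hfm) set" where
  "hker A X = {(\<phi>, \<psi>). \<phi> \<in> Fm X \<and> \<psi> \<in> Fm X \<and> hinterp A X \<phi> = hinterp A X \<psi>}"

lemma equiv_hker: "equiv (Fm X) (hker A X)"
  by (rule equivI) (auto simp: hker_def refl_on_def sym_def trans_def)

lemma fm_congruence_hker: "fm_congruence (hker A)"
  unfolding fm_congruence_def using equiv_hker by (auto simp: hker_def)

lemma fm_congruence_equiv: "fm_congruence R \<Longrightarrow> X \<in> sorts \<Longrightarrow> equiv (Fm X) (R X)"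
  by (simp add: fm_congruence_def)

lemma fm_congruenceD:
  assumes R: "fm_congruence R" and X: "X \<in> sorts"
  shows "(\<phi>, \<phi>') \<in> R X \<Longrightarrow> (HNeg \<phi>, HNeg \<phi>') \<in> R X"
    "(\<phi>, \<phi>') \<in> R X \<Longrightarrow> (\<psi>, \<psi>') \<in> R X \<Longrightarrow> (HAnd \<phi> \<psi>, HAnd \<phi>' \<psi>') \<in> R X"
    "(\<phi>, \<phi>') \<in> R X \<Longrightarrow> (\<psi>, \<psi>') \<in> R X \<Longrightarrow> (HOr \<phi> \<psi>, HOr \<phi>' \<psi>') \<in> R X"
    "(\<phi>, \<phi>') \<in> R X \<Longrightarrow> x \<in> X \<Longrightarrow> (HEx x \<phi>, HEx x \<phi>') \<in> R X"
    "(\<phi>, \<phi>') \<in> R X \<Longrightarrow> Y \<in> sorts \<Longrightarrow> s \<in> Hom X (W Y) \<Longrightarrow> (HSub X s \<phi>, HSub X s \<phi>') \<in> R Y"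
proof -
  have "\<forall>(\<phi>, \<phi>')\<in>R X. (HNeg \<phi>, HNeg \<phi>') \<in> R X"
    "\<forall>(\<phi>, \<phi>')\<in>R X. \<forall>(\<psi>, \<psi>')\<in>R X.
      (HAnd \<phi> \<psi>, HAnd \<phi>' \<psi>') \<in> R X \<and> (HOr \<phi> \<psi>, HOr \<phi>' \<psi>') \<in> R X"
    "\<forall>x\<in>X. \<forall>(\<phi>, \<phi>')\<in>R X. (HEx x \<phi>, HEx x \<phi>') \<in> R X"
    "\<forall>Y\<in>sorts. \<forall>s\<in>Hom X (W Y). \<forall>(\<phi>, \<phi>')\<in>R X. (HSub X s \<phi>, HSub X s \<phi>') \<in> R Y"
    using R X by (simp_all add: fm_congruence_def)
  then show "(\<phi>, \<phi>') \<in> R X \<Longrightarrow> (HNeg \<phi>, HNeg \<phi>') \<in> R X"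
    "(\<phi>, \<phi>') \<in> R X \<Longrightarrow> (\<psi>, \<psi>') \<in> R X \<Longrightarrow> (HAnd \<phi> \<psi>, HAnd \<phi>' \<psi>') \<in> R X"
    "(\<phi>, \<phi>') \<in> R X \<Longrightarrow> (\<psi>, \<psi>') \<in> R X \<Longrightarrow> (HOr \<phi> \<psi>, HOr \<phi>' \<psi>') \<in> R X"
    "(\<phi>, \<phi>') \<in> R X \<Longrightarrow> x \<in> X \<Longrightarrow> (HEx x \<phi>, HEx x \<phi>') \<in> R X"
    "(\<phi>, \<phi>') \<in> R X \<Longrightarrow> Y \<in> sorts \<Longrightarrow> s \<in> Hom X (W Y) \<Longrightarrow> (HSub X s \<phi>, HSub X s \<phi>') \<in> R Y"
    by blast+
qed

text \<open>The quotient operations are unions over all representatives; compatibility with R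
  collapses each union to a single class, so one can compute with any representative.\<close>

lemma fm_quotient_simps:
  assumes R: "fm_congruence R" and X: "X \<in> sorts"
  shows "hbot (fm_quotient R) X = R X `` {HBot}"
    "htop (fm_quotient R) X = R X `` {HTop}"
    "heq (fm_quotient R) X w w' = R X `` {HEq w w'}"
    "\<phi> \<in> Fm X \<Longrightarrow> hneg (fm_quotient R) X (R X `` {\<phi>}) = R X `` {HNeg \<phi>}"
    "\<phi> \<in> Fm X \<Longrightarrow> \<psi> \<in> Fm X \<Longrightarrow>
      hand (fm_quotient R) X (R X `` {\<phi>}) (R X `` {\<psi>}) = R X `` {HAnd \<phi> \<psi>}"
    "\<phi> \<in> Fm X \<Longrightarrow> \<psi> \<in> Fm X \<Longrightarrow>
      hor (fm_quotient R) X (R X `` {\<phi>}) (R X `` {\<psi>}) = R X `` {HOr \<phi> \<psi>}"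
    "\<phi> \<in> Fm X \<Longrightarrow> x \<in> X \<Longrightarrow> hex (fm_quotient R) X x (R X `` {\<phi>}) = R X `` {HEx x \<phi>}"
    "\<phi> \<in> Fm X \<Longrightarrow> Y \<in> sorts \<Longrightarrow> s \<in> Hom X (W Y) \<Longrightarrow>
      hsub (fm_quotient R) X Y s (R X `` {\<phi>}) = R Y `` {HSub X s \<phi>}"
proof -
  note eq = fm_congruence_equiv[OF R]
  show "hbot (fm_quotient R) X = R X `` {HBot}" "htop (fm_quotient R) X = R X `` {HTop}"
    "heq (fm_quotient R) X w w' = R X `` {HEq w w'}"
    by (simp_all add: fm_quotient_def)
  show "hneg (fm_quotient R) X (R X `` {\<phi>}) = R X `` {HNeg \<phi>}" if "\<phi> \<in> Fm X"
  proof -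
    have "congruent (R X) (\<lambda>\<phi>. R X `` {HNeg \<phi>})"
      by (intro congruentI equiv_class_eq[OF eq[OF X]] fm_congruenceD[OF R X])
    then show ?thesis
      using that UN_equiv_class[OF eq[OF X]] by (simp add: fm_quotient_def)
  qed
  show "hex (fm_quotient R) X x (R X `` {\<phi>}) = R X `` {HEx x \<phi>}" if "\<phi> \<in> Fm X" "x \<in> X"
  proof -
    have "congruent (R X) (\<lambda>\<phi>. R X `` {HEx x \<phi>})"
      by (intro congruentI equiv_class_eq[OF eq[OF X]] fm_congruenceD[OF R X] that(2))
    then show ?thesis
      using that UN_equiv_class[OF eq[OF X]] by (simp add: fm_quotient_def)
  qed
  show "hsub (fm_quotient R) X Y s (R X `` {\<phi>}) = R Y `` {HSub X s \<phi>}"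
    if "\<phi> \<in> Fm X" "Y \<in> sorts" "s \<in> Hom X (W Y)"
  proof -
    have "congruent (R X) (\<lambda>\<phi>. R Y `` {HSub X s \<phi>})"
      by (intro congruentI equiv_class_eq[OF eq[OF that(2)]] fm_congruenceD[OF R X] that(2,3))
    then show ?thesis
      using that UN_equiv_class[OF eq[OF X]] by (simp add: fm_quotient_def)
  qed
  show "hand (fm_quotient R) X (R X `` {\<phi>}) (R X `` {\<psi>}) = R X `` {HAnd \<phi> \<psi>}"
    if "\<phi> \<in> Fm X" "\<psi> \<in> Fm X"
  proof -
    have "congruent2 (R X) (R X) (\<lambda>\<phi> \<psi>. R X `` {HAnd \<phi> \<psi>})"
      by (intro congruent2I' equiv_class_eq[OF eq[OF X]] fm_congruenceD[OF R X])
    then show ?thesis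
      using that UN_equiv_class2[OF eq[OF X] eq[OF X]] by (simp add: fm_quotient_def)
  qed
  show "hor (fm_quotient R) X (R X `` {\<phi>}) (R X `` {\<psi>}) = R X `` {HOr \<phi> \<psi>}"
    if "\<phi> \<in> Fm X" "\<psi> \<in> Fm X"
  proof -
    have "congruent2 (R X) (R X) (\<lambda>\<phi> \<psi>. R X `` {HOr \<phi> \<psi>})"
      by (intro congruent2I' equiv_class_eq[OF eq[OF X]] fm_congruenceD[OF R X])
    then show ?thesis
      using that UN_equiv_class2[OF eq[OF X] eq[OF X]] by (simp add: fm_quotient_def)
  qed
qed

lemma hcar_fm_quotient: "hcar (fm_quotient R) X = (\<lambda>\<phi>. R X `` {\<phi>}) ` Fm X"
  by (auto simp: fm_quotient_def quotient_def)

lemma hker_class_eq_iff: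
  "\<phi> \<in> Fm X \<Longrightarrow> \<psi> \<in> Fm X \<Longrightarrow>
   hker A X `` {\<phi>} = hker A X `` {\<psi>} \<longleftrightarrow> hinterp A X \<phi> = hinterp A X \<psi>"
  by (subst eq_equiv_class_iff[OF equiv_hker]) (auto simp: hker_def)

text \<open>Every axiom of Halmos algebras is quasi-equational, so it passes from \<open>A\<close> to the quotient
  by the kernel of an interpretation in \<open>A\<close>.\<close>

lemma halmos_algebra_hker:
  assumes A: "halmos_algebra A"
  shows "halmos_algebra (fm_quotient (hker A))"
proof -
  let ?Q = "fm_quotient (hker A)"
  note q = fm_quotient_simps[OF fm_congruence_hker] hcar_fm_quotient hker_class_eq_iff
  note in_car = hinterp_in_hcar[OF A]
  have "boolean_sort ?Q X" if X: "X \<in> sorts" for X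
  proof -
    have b: "boolean_sort A X" using A X by (simp add: halmos_algebra_def)
    show ?thesis
      unfolding boolean_sort_def
      by (simp add: q X) (use b[unfolded boolean_sort_def] in_car[OF X] in blast)
  qed
  moreover have "quantifier_sort ?Q X" if X: "X \<in> sorts" for X
  proof -
    have b: "quantifier_sort A X" using A X by (simp add: halmos_algebra_def)
    show ?thesis
      unfolding quantifier_sort_def
      by (simp add: q X hle_def) (use b[unfolded quantifier_sort_def hle_def] in_car[OF X] in blast)
  qed
  moreover have "equality_sort ?Q X" if X: "X \<in> sorts" for X
  proof -
    have b: "equality_sort A X" using A X by (simp add: halmos_algebra_def)
    \<comment> \<open>The axiom on operations involves a conjunction of arbitrary length. Realizing
      it by one formula brings it within reach of the rules for classes and of the interpretation in
      A.\<close>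
    let ?meet = "\<lambda>ws ws'. foldr HAnd (map2 HEq ws ws') HTop"
    have meet: "?meet ws ws' \<in> Fm X \<and>
        foldr (hand ?Q X) (map2 (heq ?Q X) ws ws') (htop ?Q X) = hker A X `` {?meet ws ws'} \<and>
        hinterp A X (?meet ws ws') = foldr (hand A X) (map2 (heq A X) ws ws') (htop A X)"
      if "length ws = length ws'" "set ws \<subseteq> car (W X)" "set ws' \<subseteq> car (W X)" for ws ws'
      using that by (induction ws ws' rule: list_induct2) (simp_all add: q X)
    have "hle ?Q X (foldr (hand ?Q X) (map2 (heq ?Q X) ws ws') (htop ?Q X))
        (heq ?Q X (opn (W X) f ws) (opn (W X) f ws'))"
      if ws: "length ws = ar f \<and> length ws' = ar f \<and> set ws \<subseteq> car (W X) \<and> set ws' \<subseteq> car (W X)"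
      for f ws ws'
    proof -
      have "length ws = length ws'" using ws by simp
      note m = meet[OF this, THEN conjunct1] meet[OF this, THEN conjunct2, THEN conjunct1]
        meet[OF this, THEN conjunct2, THEN conjunct2]
      have "hle A X (foldr (hand A X) (map2 (heq A X) ws ws') (htop A X))
          (heq A X (opn (W X) f ws) (opn (W X) f ws'))"
        using b ws unfolding equality_sort_def by blast
      then show ?thesis
        using ws unfolding hle_def
        by (simp add: m(2)) (simp add: q X m(1,3) opn_W_closed)
    qed
    moreover have "\<forall>w\<in>car (W X). heq ?Q X w w = htop ?Q X"
      "\<forall>w\<in>car (W X). \<forall>w'\<in>car (W X). heq ?Q X w w' \<in> hcar ?Q X \<and> heq ?Q X w w' = heq ?Q X w' w"
      "\<forall>w\<in>car (W X). \<forall>w'\<in>car (W X). \<forall>w''\<in>car (W X).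
        hle ?Q X (hand ?Q X (heq ?Q X w w') (heq ?Q X w' w'')) (heq ?Q X w w'')"
      by (simp_all add: q X hle_def) (use b[unfolded equality_sort_def hle_def] in blast)+
    ultimately show ?thesis
      unfolding equality_sort_def by blast
  qed
  moreover have "substitution_hom ?Q"
  proof -
    have b: "substitution_hom A" using A by (simp add: halmos_algebra_def)
    show ?thesis
      unfolding substitution_hom_def
      by (simp add: q id_in_Hom_W compose_in_Hom)
        (use b[unfolded substitution_hom_def] in_car in blast)
  qed
  moreover have "substitution_quantifier ?Q"
  proof -
    have b: "substitution_quantifier A" using A by (simp add: halmos_algebra_def)
    note b1 = b[unfolded substitution_quantifier_def, THEN conjunct1, rule_format]
    note b2 = b[unfolded substitution_quantifier_def, THEN conjunct2, rule_format]
    show ?thesis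
      unfolding substitution_quantifier_def
    proof (intro conjI ballI impI)
      fix X Y s1 s2 x a
      assume *: "X \<in> sorts" "Y \<in> sorts" "s1 \<in> Hom X (W Y)" "s2 \<in> Hom X (W Y)" "x \<in> X"
        and a: "a \<in> hcar ?Q X" and eq: "\<forall>y\<in>X - {x}. s1 (gen X y) = s2 (gen X y)"
      obtain \<phi> where \<phi>: "\<phi> \<in> Fm X" "a = hker A X `` {\<phi>}"
        using a by (auto simp: q)
      have "hsub A X Y s1 (hex A X x (hinterp A X \<phi>)) = hsub A X Y s2 (hex A X x (hinterp A X \<phi>))"
        using eq by (intro b1 * in_car \<phi>(1)) blast
      then show "hsub ?Q X Y s1 (hex ?Q X x a) = hsub ?Q X Y s2 (hex ?Q X x a)"
        using * \<phi> by (simp add: q)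
    next
      fix X Y s x y a
      assume *: "X \<in> sorts" "Y \<in> sorts" "s \<in> Hom X (W Y)" "x \<in> X" "y \<in> Y"
        and a: "a \<in> hcar ?Q X"
        and eq: "s (gen X x) = gen Y y \<and> (\<forall>x'\<in>X - {x}. not_in_support Y y (s (gen X x')))"
      obtain \<phi> where \<phi>: "\<phi> \<in> Fm X" "a = hker A X `` {\<phi>}"
        using a by (auto simp: q)
      have "hsub A X Y s (hex A X x (hinterp A X \<phi>)) = hex A Y y (hsub A X Y s (hinterp A X \<phi>))"
        using eq by (intro b2 * in_car \<phi>(1)) blast
      then show "hsub ?Q X Y s (hex ?Q X x a) = hex ?Q Y y (hsub ?Q X Y s a)"
        using * \<phi> by (simp add: q)
    qed
  qed
  moreover have "substitution_equality ?Q"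
  proof -
    have b: "substitution_equality A" using A by (simp add: halmos_algebra_def)
    note b1 = b[unfolded substitution_equality_def, THEN conjunct1, rule_format]
    note b2 = b[unfolded substitution_equality_def, THEN conjunct2, rule_format]
    show ?thesis
      unfolding substitution_equality_def
    proof (intro conjI ballI impI)
      fix X Y s w w'
      assume *: "X \<in> sorts" "Y \<in> sorts" "s \<in> Hom X (W Y)" "w \<in> car (W X)" "w' \<in> car (W X)"
      then show "hsub ?Q X Y s (heq ?Q X w w') = heq ?Q Y (s w) (s w')"
        using b1[OF *] by (simp add: q Hom_in_car)
    next
      fix X s s' x a
      assume *: "X \<in> sorts" "s \<in> Hom X (W X)" "s' \<in> Hom X (W X)" "x \<in> X"
        and a: "a \<in> hcar ?Q X"
        and eq: "\<forall>y\<in>X - {x}. s (gen X y) = gen X y \<and> s' (gen X y) = gen X y"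
      obtain \<phi> where \<phi>: "\<phi> \<in> Fm X" "a = hker A X `` {\<phi>}"
        using a by (auto simp: q)
      have "hle A X (hand A X (hsub A X X s (hinterp A X \<phi>)) (heq A X (s (gen X x)) (s' (gen X x))))
          (hsub A X X s' (hinterp A X \<phi>))"
        using eq by (intro b2 * in_car \<phi>(1)) blast
      then show "hle ?Q X (hand ?Q X (hsub ?Q X X s a) (heq ?Q X (s (gen X x)) (s' (gen X x))))
          (hsub ?Q X X s' a)"
        using * \<phi> by (simp add: q hle_def Hom_in_car gen_in_W)
    qed
  qed
  ultimately show ?thesis
    by (simp add: halmos_algebra_def)
qed

text \<open>\<open>halmos_cong\<close> is an intersection of congruences on formulas, whereas A may
  have elements of any type. Its kernel is the congruence through which A enters that
  intersection.\<close>

lemma halmos_cong_subset_hker: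
  "halmos_algebra A \<Longrightarrow> halmos_cong X \<subseteq> hker A X"
  using fm_congruence_hker halmos_algebra_hker unfolding halmos_cong_def by blast

lemma fm_congruence_halmos_cong: "fm_congruence halmos_cong"
proof -
  have "equiv (Fm X) (halmos_cong X)" if X: "X \<in> sorts" for X
  proof (rule equivI)
    note eq = fm_congruence_equiv[OF _ X]
    show "halmos_cong X \<subseteq> Fm X \<times> Fm X" by (auto simp: halmos_cong_def)
    show "refl_on (Fm X) (halmos_cong X)"
      using eq unfolding halmos_cong_def equiv_def refl_on_def by blast
    show "sym (halmos_cong X)"
      using eq unfolding halmos_cong_def equiv_def sym_def by blast
    show "trans (halmos_cong X)"
      using eq unfolding halmos_cong_def equiv_def trans_def by blast
  qed
  then show ?thesis
    unfolding fm_congruence_def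
    by (auto simp: halmos_cong_def intro: fm_congruenceD)
qed

lemma halmos_cong_some:
  assumes "\<phi> \<in> Fm X" "X \<in> sorts"
  shows "(\<phi>, SOME \<psi>. \<psi> \<in> halmos_cong X `` {\<phi>}) \<in> halmos_cong X"
proof -
  have "\<phi> \<in> halmos_cong X `` {\<phi>}"
    by (rule equiv_class_self[OF fm_congruence_equiv[OF fm_congruence_halmos_cong assms(2)] assms(1)])
  then have "(SOME \<psi>. \<psi> \<in> halmos_cong X `` {\<phi>}) \<in> halmos_cong X `` {\<phi>}"
    by (rule someI)
  then show ?thesis by simp
qed

section \<open>The universal property of \<open>Phi\<close> and the computation of
  \<open>Val\<close>\<close>

lemma Phi_hom_exists:
  assumes A: "halmos_algebra A"
  shows "\<exists>F. halmos_hom Phi A F"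
proof
  \<comment> \<open>Any representative will do: related formulas lie in the kernel of A, so the
    interpretation is constant on classes.\<close>
  define F where "F = (\<lambda>X u. hinterp A X (SOME \<phi>. \<phi> \<in> u))"
  have F: "F X (halmos_cong X `` {\<phi>}) = hinterp A X \<phi>" if "X \<in> sorts" "\<phi> \<in> Fm X" for X \<phi>
    using halmos_cong_some[OF that(2,1)] halmos_cong_subset_hker[OF A, of X]
    unfolding F_def hker_def by auto
  show "halmos_hom Phi A F"
    unfolding halmos_hom_def Phi_def
    by (simp add: fm_quotient_simps[OF fm_congruence_halmos_cong] hcar_fm_quotient F
        hinterp_in_hcar[OF A] Pi_iff)
qed

text \<open>Elements of \<open>Phi\<close> are classes of formulas built from formal equalities, so
  induction on the formula leaves F no freedom. Off the carriers F may be arbitrary, which is why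
  the claim concerns classes of well-sorted formulas.\<close>

lemma Phi_hom_unique:
  assumes F: "halmos_hom Phi A F"
  shows "X \<in> sorts \<Longrightarrow> \<phi> \<in> Fm X \<Longrightarrow> F X (halmos_cong X `` {\<phi>}) = hinterp A X \<phi>"
proof (induction \<phi> arbitrary: X)
qed (use F in \<open>simp_all add: halmos_hom_def Phi_def hcar_fm_quotient
      fm_quotient_simps[OF fm_congruence_halmos_cong]\<close>)

theorem Val_class:
  assumes "in_variety H" "X \<in> sorts" "\<phi> \<in> Fm X"
  shows "Val H X (halmos_cong X `` {\<phi>}) = hinterp (Hal H) X \<phi>"
proof -
  have "halmos_hom Phi (Hal H) (Val H)"
    unfolding Val_def using Phi_hom_exists[OF halmos_algebra_Hal[OF assms(1)]] by (rule someI_ex)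
  then show ?thesis using Phi_hom_unique assms by blast
qed

end


section \<open>Halmos formulas and special first-order formulas\<close>

fun fo_sat :: "('f, 'a) alg \<Rightarrow> ('v \<Rightarrow> 'a) \<Rightarrow> ('f, 'v) fo \<Rightarrow> bool" where
  "fo_sat H \<rho> (FEq t t') \<longleftrightarrow> eval H \<rho> t = eval H \<rho> t'"
| "fo_sat H \<rho> (FNeg p) \<longleftrightarrow> \<not> fo_sat H \<rho> p"
| "fo_sat H \<rho> (FAnd p q) \<longleftrightarrow> fo_sat H \<rho> p \<and> fo_sat H \<rho> q"
| "fo_sat H \<rho> (FOr p q) \<longleftrightarrow> fo_sat H \<rho> p \<or> fo_sat H \<rho> q"
| "fo_sat H \<rho> (FEx x p) \<longleftrightarrow> (\<exists>v\<in>car H. fo_sat H (\<rho>(x := v)) p)"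

lemma fo_sat_cong:
  "(\<And>x. x \<in> free_vars p \<Longrightarrow> \<rho> x = \<rho>' x) \<Longrightarrow> fo_sat H \<rho> p \<longleftrightarrow> fo_sat H \<rho>' p"
proof (induction p arbitrary: \<rho> \<rho>')
  case (FEq t t')
  then show ?case using eval_cong[of t \<rho> \<rho>' H] eval_cong[of t' \<rho> \<rho>' H] by simp
next
  case (FNeg p)
  then show ?case by (metis fo_sat.simps(2) free_vars.simps(2))
next
  case (FAnd p q)
  then show ?case by (metis UnI1 UnI2 fo_sat.simps(3) free_vars.simps(3))
next
  case (FOr p q)
  then show ?case by (metis UnI1 UnI2 fo_sat.simps(4) free_vars.simps(4))
next
  case (FEx x p)
  have "fo_sat H (\<rho>(x := v)) p \<longleftrightarrow> fo_sat H (\<rho>'(x := v)) p" for v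
    using FEx.prems by (intro FEx.IH) auto
  then show ?case by simp
qed

text \<open>Serves two purposes: with empty V and \<open>\<sigma>\<close> read off from a
  homomorphism it executes a substitution between sorts; with \<open>\<sigma> = Var\<close> and V =
  X it renames bound variables out of X. The induction generalizes \<open>\<sigma>\<close>, since
  passing under a quantifier changes its value at the bound variable.\<close>

lemma fo_subst_exists:
  fixes \<sigma> :: "'v \<Rightarrow> ('f, 'v) trm"
  assumes inf: "infinite (UNIV :: 'v set)" and V: "finite V"
  shows "wf_fo ar p \<Longrightarrow> (\<And>x. wf_trm ar (\<sigma> x)) \<Longrightarrow>
    \<exists>p'. wf_fo ar p' \<and> free_vars p' \<subseteq> (\<Union>x\<in>free_vars p. tvars (\<sigma> x)) \<and>
      bound_vars p' \<inter> V = {} \<and>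
      (\<forall>\<rho>. fo_sat H \<rho> p' \<longleftrightarrow> fo_sat H (\<lambda>x. eval H \<rho> (\<sigma> x)) p)"
proof (induction p arbitrary: \<sigma>)
  case (FEq t t')
  then show ?case
    by (intro exI[of _ "FEq (tsubst \<sigma> t) (tsubst \<sigma> t')"])
      (auto simp: wf_trm_tsubst tvars_tsubst eval_tsubst)
next
  case (FNeg p)
  then obtain p' where "wf_fo ar p'" "free_vars p' \<subseteq> (\<Union>x\<in>free_vars p. tvars (\<sigma> x))"
    "bound_vars p' \<inter> V = {}" "\<forall>\<rho>. fo_sat H \<rho> p' \<longleftrightarrow> fo_sat H (\<lambda>x. eval H \<rho> (\<sigma> x)) p"
    by (metis wf_fo.simps(2))
  then show ?case by (intro exI[of _ "FNeg p'"]) auto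
next
  case (FAnd p q)
  obtain p' where "wf_fo ar p'" "free_vars p' \<subseteq> (\<Union>x\<in>free_vars p. tvars (\<sigma> x))"
    "bound_vars p' \<inter> V = {}" "\<forall>\<rho>. fo_sat H \<rho> p' \<longleftrightarrow> fo_sat H (\<lambda>x. eval H \<rho> (\<sigma> x)) p"
    using FAnd by (metis wf_fo.simps(3))
  moreover obtain q' where "wf_fo ar q'" "free_vars q' \<subseteq> (\<Union>x\<in>free_vars q. tvars (\<sigma> x))"
    "bound_vars q' \<inter> V = {}" "\<forall>\<rho>. fo_sat H \<rho> q' \<longleftrightarrow> fo_sat H (\<lambda>x. eval H \<rho> (\<sigma> x)) q"
    using FAnd by (metis wf_fo.simps(3))
  ultimately show ?case by (intro exI[of _ "FAnd p' q'"]) auto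
next
  case (FOr p q)
  obtain p' where "wf_fo ar p'" "free_vars p' \<subseteq> (\<Union>x\<in>free_vars p. tvars (\<sigma> x))"
    "bound_vars p' \<inter> V = {}" "\<forall>\<rho>. fo_sat H \<rho> p' \<longleftrightarrow> fo_sat H (\<lambda>x. eval H \<rho> (\<sigma> x)) p"
    using FOr by (metis wf_fo.simps(4))
  moreover obtain q' where "wf_fo ar q'" "free_vars q' \<subseteq> (\<Union>x\<in>free_vars q. tvars (\<sigma> x))"
    "bound_vars q' \<inter> V = {}" "\<forall>\<rho>. fo_sat H \<rho> q' \<longleftrightarrow> fo_sat H (\<lambda>x. eval H \<rho> (\<sigma> x)) q"
    using FOr by (metis wf_fo.simps(4))
  ultimately show ?case by (intro exI[of _ "FOr p' q'"]) auto
next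
  case (FEx x p)
  \<comment> \<open>The new bound variable z has to avoid V and every variable of a term substituted
    for a free variable of p; the latter condition excludes capture.\<close>
  have "finite (V \<union> (\<Union>y\<in>free_vars p. tvars (\<sigma> y)))"
    using V finite_free_vars finite_tvars by blast
  then obtain z where z: "z \<notin> V" "\<And>y. y \<in> free_vars p \<Longrightarrow> z \<notin> tvars (\<sigma> y)"
    using ex_new_if_finite[OF inf] by blast
  have "wf_trm ar ((\<sigma>(x := Var z)) y)" for y
    using FEx.prems(2) by simp
  then obtain p' where p': "wf_fo ar p'" "free_vars p' \<subseteq> (\<Union>y\<in>free_vars p. tvars ((\<sigma>(x := Var z)) y))"
    "bound_vars p' \<inter> V = {}"
    "\<And>\<rho>. fo_sat H \<rho> p' \<longleftrightarrow> fo_sat H (\<lambda>y. eval H \<rho> ((\<sigma>(x := Var z)) y)) p"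
    using FEx.IH[of "\<sigma>(x := Var z)"] FEx.prems(1) by (auto simp del: fun_upd_apply)
  have "fo_sat H (\<rho>(z := v)) p' \<longleftrightarrow> fo_sat H ((\<lambda>y. eval H \<rho> (\<sigma> y))(x := v)) p" for \<rho> v
    unfolding p'(4)
  proof (rule fo_sat_cong)
    fix y assume "y \<in> free_vars p"
    then show "eval H (\<rho>(z := v)) ((\<sigma>(x := Var z)) y) = ((\<lambda>y. eval H \<rho> (\<sigma> y))(x := v)) y"
      using z(2) by (auto intro!: eval_cong)
  qed
  moreover have "free_vars p' - {z} \<subseteq> (\<Union>y\<in>free_vars p - {x}. tvars (\<sigma> y))"
    using p'(2) by (fastforce split: if_splits)
  ultimately show ?case
    using p'(1,3) z(1) by (intro exI[of _ "FEx z p'"]) auto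
qed

context variety
begin

text \<open>\<open>Tp\<close> quantifies over all extensions of a point to the full set of
  variables. The existence of one, due to the nonempty carrier, keeps that condition from being
  vacuous.\<close>

lemma Hom_extend:
  assumes H: "in_variety H" and \<mu>: "\<mu> \<in> Hom X H"
  obtains \<eta> where "\<eta> \<in> Hom UNIV H" "\<forall>x\<in>X. \<eta> (gen UNIV x) = \<mu> (gen X x)"
proof -
  obtain h where h: "h \<in> car H" using H by (auto simp: in_variety_def)
  let ?\<rho> = "\<lambda>x. if x \<in> X then \<mu> (gen X x) else h"
  have "?\<rho> x \<in> car H" for x
    using h \<mu> gen_in_W by (auto intro: Hom_in_car)
  then show thesis
    using hom_ext_in_Hom[OF H, of ?\<rho>] hom_ext_gen[OF H, of ?\<rho>]
    by (intro that[of "hom_ext UNIV H ?\<rho>"]) auto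
qed

section \<open>Agreement of the interpretation in \<open>Hal H\<close> with first-order
  satisfaction\<close>

lemma hinterp_Hal_subset:
  "in_variety H \<Longrightarrow> X \<in> sorts \<Longrightarrow> \<phi> \<in> Fm X \<Longrightarrow> hinterp (Hal H) X \<phi> \<subseteq> Hom X H"
  using hinterp_in_hcar[OF halmos_algebra_Hal] by auto

lemma fo_to_hfm_in_Fm: "wf_fo ar p \<Longrightarrow> fo_to_hfm p \<in> Fm UNIV"
  by (induction p) (auto simp: car_W Trm_def)

text \<open>The bridge between two readings of a quantifier: passing to a point that differs at one
  generator, and updating a total valuation. The body is abstracted to P so that the result applies
  both to first-order formulas in sort \<open>UNIV\<close> and to formulas of an arbitrary
  sort.\<close>

lemma hex_Hal_iff:
  assumes H: "in_variety H" and \<mu>: "\<mu> \<in> Hom X H" and x: "x \<in> X" and a: "a \<subseteq> Hom X H"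
    and \<rho>: "\<And>y. \<rho> y \<in> car H" "\<And>y. y \<in> X \<Longrightarrow> \<rho> y = \<mu> (gen X y)"
    and P: "\<And>\<nu> \<rho>'. \<nu> \<in> Hom X H \<Longrightarrow> (\<And>y. \<rho>' y \<in> car H) \<Longrightarrow>
      (\<And>y. y \<in> X \<Longrightarrow> \<rho>' y = \<nu> (gen X y)) \<Longrightarrow> \<nu> \<in> a \<longleftrightarrow> P \<rho>'"
  shows "\<mu> \<in> hex (Hal H) X x a \<longleftrightarrow> (\<exists>v\<in>car H. P (\<rho>(x := v)))"
proof
  assume "\<mu> \<in> hex (Hal H) X x a"
  then obtain \<nu> where \<nu>: "\<nu> \<in> a" "\<And>y. y \<in> X - {x} \<Longrightarrow> \<nu> (gen X y) = \<mu> (gen X y)"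
    by auto
  then have "\<nu> \<in> Hom X H" using a by auto
  moreover from this have v: "\<nu> (gen X x) \<in> car H" using gen_in_W[OF x] by (rule Hom_in_car)
  ultimately have "P (\<rho>(x := \<nu> (gen X x)))"
    using P[of \<nu> "\<rho>(x := \<nu> (gen X x))"] \<nu> \<rho> by auto
  then show "\<exists>v\<in>car H. P (\<rho>(x := v))" using v by blast
next
  assume "\<exists>v\<in>car H. P (\<rho>(x := v))"
  then obtain v where v: "v \<in> car H" "P (\<rho>(x := v))" by blast
  obtain \<nu> where \<nu>: "\<nu> \<in> Hom X H" "\<nu> (gen X x) = v"
    "\<And>y. y \<in> X \<Longrightarrow> y \<noteq> x \<Longrightarrow> \<nu> (gen X y) = \<mu> (gen X y)"
    using Hom_update[OF H \<mu> v(1)] x by metis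
  then have "\<nu> \<in> a"
    using P[of \<nu> "\<rho>(x := v)"] v \<rho> by auto
  then show "\<mu> \<in> hex (Hal H) X x a"
    using \<mu> \<nu> by (intro hex_HalI[where \<nu> = \<nu>]) auto
qed

lemma fo_to_hfm_sat:
  assumes H: "in_variety H"
  shows "wf_fo ar p \<Longrightarrow> \<eta> \<in> Hom UNIV H \<Longrightarrow>
    \<eta> \<in> hinterp (Hal H) UNIV (fo_to_hfm p) \<longleftrightarrow> fo_sat H (\<lambda>x. \<eta> (gen UNIV x)) p"
proof (induction p arbitrary: \<eta>)
  case (FEq t t')
  then have "t \<in> Trm ar UNIV" "t' \<in> Trm ar UNIV" by (auto simp: Trm_def)
  then show ?case using FEq.prems by (simp add: Hom_tclass)
next
  case (FEx x p)
  have "hinterp (Hal H) UNIV (fo_to_hfm p) \<subseteq> Hom UNIV H"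
    using FEx.prems by (intro hinterp_Hal_subset[OF H] fo_to_hfm_in_Fm) (auto simp: sorts_def)
  moreover have "\<nu> \<in> hinterp (Hal H) UNIV (fo_to_hfm p) \<longleftrightarrow> fo_sat H \<rho>' p"
    if "\<nu> \<in> Hom UNIV H" "\<And>y. y \<in> UNIV \<Longrightarrow> \<rho>' y = \<nu> (gen UNIV y)" for \<nu> \<rho>'
  proof -
    have "\<rho>' = (\<lambda>y. \<nu> (gen UNIV y))" using that(2) by auto
    then show ?thesis using FEx that(1) by simp
  qed
  ultimately have "\<eta> \<in> hex (Hal H) UNIV x (hinterp (Hal H) UNIV (fo_to_hfm p)) \<longleftrightarrow>
      (\<exists>v\<in>car H. fo_sat H ((\<lambda>y. \<eta> (gen UNIV y))(x := v)) p)"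
    using FEx.prems(2) gen_in_W by (intro hex_Hal_iff[OF H]) (auto intro: Hom_in_car)
  then show ?case by (simp only: fo_to_hfm.simps hinterp.simps fo_sat.simps)
qed auto

text \<open>Ranging over all total extensions \<open>\<rho>\<close> of \<open>\<mu>\<close> builds
  independence from the values off X into the notion, so updates and substitutions keep it intact. A
  single H suffices because definability is relative to H.\<close>

definition fo_represents ::
  "('f, 'a) alg \<Rightarrow> 'v set \<Rightarrow> ('v, ('f, 'v) trm set) hfm \<Rightarrow> ('f, 'v) fo \<Rightarrow> bool" where
  "fo_represents H X \<phi> p \<longleftrightarrow> wf_fo ar p \<and> free_vars p \<subseteq> X \<and>
     (\<forall>\<mu>\<in>Hom X H. \<forall>\<rho>. (\<forall>x. \<rho> x \<in> car H) \<longrightarrow> (\<forall>x\<in>X. \<rho> x = \<mu> (gen X x)) \<longrightarrow>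
       (\<mu> \<in> hinterp (Hal H) X \<phi> \<longleftrightarrow> fo_sat H \<rho> p))"

lemma fo_representsI:
  assumes "wf_fo ar p" "free_vars p \<subseteq> X"
    and "\<And>\<mu> \<rho>. \<mu> \<in> Hom X H \<Longrightarrow> \<forall>x. \<rho> x \<in> car H \<Longrightarrow> \<forall>x\<in>X. \<rho> x = \<mu> (gen X x) \<Longrightarrow>
      \<mu> \<in> hinterp (Hal H) X \<phi> \<longleftrightarrow> fo_sat H \<rho> p"
  shows "fo_represents H X \<phi> p"
  unfolding fo_represents_def using assms by (intro conjI ballI allI impI) assumption+

lemma fo_representsD:
  assumes "fo_represents H X \<phi> p"
  shows "wf_fo ar p" "free_vars p \<subseteq> X"
    "\<mu> \<in> Hom X H \<Longrightarrow> \<forall>x. \<rho> x \<in> car H \<Longrightarrow> \<forall>x\<in>X. \<rho> x = \<mu> (gen X x) \<Longrightarrow>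
      \<mu> \<in> hinterp (Hal H) X \<phi> \<longleftrightarrow> fo_sat H \<rho> p"
  using assms by (simp_all only: fo_represents_def)

lemma fo_represents_exists:
  assumes H: "in_variety H"
  shows "X \<in> sorts \<Longrightarrow> \<phi> \<in> Fm X \<Longrightarrow> \<exists>p. fo_represents H X \<phi> p"
proof (induction \<phi> arbitrary: X)
  case (HEq w w')
  then obtain t t' where t: "t \<in> Trm ar X" "w = tclass X t" "t' \<in> Trm ar X" "w' = tclass X t'"
    by (auto simp: car_W)
  have "fo_represents H X (HEq w w') (FEq t t')"
  proof (rule fo_representsI)
    fix \<mu> \<rho> assume \<mu>: "\<mu> \<in> Hom X H" and \<rho>: "\<forall>x\<in>X. \<rho> x = \<mu> (gen X x)"
    have "eval H \<rho> s = eval H (\<lambda>x. \<mu> (gen X x)) s" if "s \<in> Trm ar X" for s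
      using that \<rho> by (intro eval_cong) (auto simp: Trm_def)
    then show "\<mu> \<in> hinterp (Hal H) X (HEq w w') \<longleftrightarrow> fo_sat H \<rho> (FEq t t')"
      using t \<mu> by (simp add: Hom_tclass)
  qed (use t in \<open>auto simp: Trm_def\<close>)
  then show ?case by blast
next
  case HBot
  \<comment> \<open>First-order formulas have no truth constants and X may be empty, so a closed
    formula is required; it gets the right truth value because the carrier is nonempty. The same
    device serves \<open>HTop\<close>.\<close>
  fix x :: 'v
  have "car H \<noteq> {}" using H by (simp add: in_variety_def)
  then have "fo_represents H X HBot (FNeg (FEx x (FEq (Var x) (Var x))))"
    by (intro fo_representsI) auto
  then show ?case by blast
next
  case HTop
  fix x :: 'v
  have "car H \<noteq> {}" using H by (simp add: in_variety_def)
  then have "fo_represents H X HTop (FEx x (FEq (Var x) (Var x)))"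
    by (intro fo_representsI) auto
  then show ?case by blast
next
  case (HNeg \<phi>)
  then obtain p where p: "fo_represents H X \<phi> p" by auto
  have "fo_represents H X (HNeg \<phi>) (FNeg p)"
  proof (rule fo_representsI)
    fix \<mu> \<rho> assume *: "\<mu> \<in> Hom X H" "\<forall>x. \<rho> x \<in> car H" "\<forall>x\<in>X. \<rho> x = \<mu> (gen X x)"
    then show "\<mu> \<in> hinterp (Hal H) X (HNeg \<phi>) \<longleftrightarrow> fo_sat H \<rho> (FNeg p)"
      by (simp add: fo_representsD(3)[OF p *])
  qed (use fo_representsD(1,2)[OF p] in simp_all)
  then show ?case by blast
next
  case (HAnd \<phi> \<psi>)
  then obtain p q where p: "fo_represents H X \<phi> p" and q: "fo_represents H X \<psi> q" by fastforce
  have "fo_represents H X (HAnd \<phi> \<psi>) (FAnd p q)"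
  proof (rule fo_representsI)
    fix \<mu> \<rho> assume *: "\<mu> \<in> Hom X H" "\<forall>x. \<rho> x \<in> car H" "\<forall>x\<in>X. \<rho> x = \<mu> (gen X x)"
    show "\<mu> \<in> hinterp (Hal H) X (HAnd \<phi> \<psi>) \<longleftrightarrow> fo_sat H \<rho> (FAnd p q)"
      by (simp add: fo_representsD(3)[OF p *] fo_representsD(3)[OF q *])
  qed (use fo_representsD(1,2)[OF p] fo_representsD(1,2)[OF q] in simp_all)
  then show ?case by blast
next
  case (HOr \<phi> \<psi>)
  then obtain p q where p: "fo_represents H X \<phi> p" and q: "fo_represents H X \<psi> q" by fastforce
  have "fo_represents H X (HOr \<phi> \<psi>) (FOr p q)"
  proof (rule fo_representsI)
    fix \<mu> \<rho> assume *: "\<mu> \<in> Hom X H" "\<forall>x. \<rho> x \<in> car H" "\<forall>x\<in>X. \<rho> x = \<mu> (gen X x)"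
    show "\<mu> \<in> hinterp (Hal H) X (HOr \<phi> \<psi>) \<longleftrightarrow> fo_sat H \<rho> (FOr p q)"
      by (simp add: fo_representsD(3)[OF p *] fo_representsD(3)[OF q *])
  qed (use fo_representsD(1,2)[OF p] fo_representsD(1,2)[OF q] in simp_all)
  then show ?case by blast
next
  case (HEx x \<phi>)
  then have x: "x \<in> X" and \<phi>: "\<phi> \<in> Fm X" by auto
  then obtain p where p: "fo_represents H X \<phi> p"
    using HEx.IH[OF HEx.prems(1)] by blast
  have "fo_represents H X (HEx x \<phi>) (FEx x p)"
  proof (rule fo_representsI)
    fix \<mu> \<rho> assume \<mu>: "\<mu> \<in> Hom X H" and \<rho>: "\<forall>x. \<rho> x \<in> car H" "\<forall>x\<in>X. \<rho> x = \<mu> (gen X x)"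
    have "\<nu> \<in> hinterp (Hal H) X \<phi> \<longleftrightarrow> fo_sat H \<rho>' p"
      if "\<nu> \<in> Hom X H" "\<And>y. \<rho>' y \<in> car H" "\<And>y. y \<in> X \<Longrightarrow> \<rho>' y = \<nu> (gen X y)" for \<nu> \<rho>'
      using that by (intro fo_representsD(3)[OF p]) auto
    then have "\<mu> \<in> hex (Hal H) X x (hinterp (Hal H) X \<phi>) \<longleftrightarrow> (\<exists>v\<in>car H. fo_sat H (\<rho>(x := v)) p)"
      using \<rho> by (intro hex_Hal_iff[OF H \<mu> x hinterp_Hal_subset[OF H HEx.prems(1) \<phi>]]) blast+
    then show "\<mu> \<in> hinterp (Hal H) X (HEx x \<phi>) \<longleftrightarrow> fo_sat H \<rho> (FEx x p)"
      by (simp only: hinterp.simps fo_sat.simps)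
  qed (use fo_representsD(1,2)[OF p] in auto)
  then show ?case by blast
next
  case (HSub Y s \<phi>)
  then have s: "s \<in> Hom Y (W X)" and Y: "Y \<in> sorts" and \<phi>: "\<phi> \<in> Fm Y" by auto
  obtain p where p: "fo_represents H Y \<phi> p"
    using HSub.IH[OF Y \<phi>] by blast
  \<comment> \<open>On Y the term represents the image of the generator under s. Outside Y only
    well-formedness matters, because the free variables of p lie in Y; \<open>Var y\<close> is a
    default.\<close>
  have "\<forall>y. \<exists>t. wf_trm ar t \<and> (y \<in> Y \<longrightarrow> t \<in> Trm ar X \<and> s (gen Y y) = tclass X t)"
  proof
    fix y
    show "\<exists>t. wf_trm ar t \<and> (y \<in> Y \<longrightarrow> t \<in> Trm ar X \<and> s (gen Y y) = tclass X t)"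
    proof (cases "y \<in> Y")
      case True
      then show ?thesis using Hom_in_car[OF s gen_in_W[OF True]] by (auto simp: car_W Trm_def)
    next
      case False
      then show ?thesis by (intro exI[of _ "Var y"]) simp
    qed
  qed
  then obtain \<sigma> where \<sigma>: "\<And>y. wf_trm ar (\<sigma> y)"
    "\<And>y. y \<in> Y \<Longrightarrow> \<sigma> y \<in> Trm ar X" "\<And>y. y \<in> Y \<Longrightarrow> s (gen Y y) = tclass X (\<sigma> y)"
    by metis
  obtain p' where p': "wf_fo ar p'" "free_vars p' \<subseteq> (\<Union>x\<in>free_vars p. tvars (\<sigma> x))"
    "\<And>\<rho>. fo_sat H \<rho> p' \<longleftrightarrow> fo_sat H (\<lambda>x. eval H \<rho> (\<sigma> x)) p"
    using fo_subst_exists[OF infinite_vars finite.emptyI fo_representsD(1)[OF p], of \<sigma> H] \<sigma>(1)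
    by blast
  have "fo_represents H X (HSub Y s \<phi>) p'"
  proof (rule fo_representsI)
    have "tvars (\<sigma> x) \<subseteq> X" if "x \<in> free_vars p" for x
      using that \<sigma>(2) fo_representsD(2)[OF p] by (auto simp: Trm_def)
    then show "free_vars p' \<subseteq> X" using p'(2) by blast
    fix \<mu> \<rho> assume \<mu>: "\<mu> \<in> Hom X H" and \<rho>: "\<forall>x. \<rho> x \<in> car H" "\<forall>x\<in>X. \<rho> x = \<mu> (gen X x)"
    have "eval H \<rho> (\<sigma> y) \<in> car H" for y
      using \<rho>(1) \<sigma>(1) by (intro eval_in_car[OF H, of UNIV]) (auto simp: Trm_def)
    moreover have "eval H \<rho> (\<sigma> y) = compose (car (W Y)) \<mu> s (gen Y y)" if y: "y \<in> Y" for y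
    proof -
      have "eval H \<rho> (\<sigma> y) = eval H (\<lambda>x. \<mu> (gen X x)) (\<sigma> y)"
        using \<rho>(2) \<sigma>(2)[OF y] by (intro eval_cong) (auto simp: Trm_def)
      then show ?thesis
        using \<mu> \<sigma>(2,3)[OF y] gen_in_W[OF y] by (simp add: compose_eq Hom_tclass)
    qed
    ultimately have "compose (car (W Y)) \<mu> s \<in> hinterp (Hal H) Y \<phi> \<longleftrightarrow> fo_sat H \<rho> p'"
      unfolding p'(3) by (intro fo_representsD(3)[OF p] compose_in_Hom[OF s \<mu>]) auto
    then show "\<mu> \<in> hinterp (Hal H) X (HSub Y s \<phi>) \<longleftrightarrow> fo_sat H \<rho> p'"
      using \<mu> by simp
  qed (rule p'(1))
  then show ?case by blast
qed

section \<open>Passing between sort X and special elements of sort \<open>UNIV\<close>\<close>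

lemma Val_special:
  assumes H: "in_variety H" and p: "wf_fo ar p" and \<eta>: "\<eta> \<in> Hom UNIV H"
  shows "\<eta> \<in> Val H UNIV (halmos_cong UNIV `` {fo_to_hfm p}) \<longleftrightarrow> fo_sat H (\<lambda>x. \<eta> (gen UNIV x)) p"
  using Val_class[OF H _ fo_to_hfm_in_Fm[OF p]] fo_to_hfm_sat[OF H p \<eta>] by (simp add: sorts_def)

text \<open>A representing first-order formula has its free variables in X already; renaming its
  bound variables away from X makes it special. The equivalence is stated for each extension
  \<open>\<eta>\<close> separately, since \<open>Tp\<close> needs all extensions and consistency
  needs just one.\<close>

lemma special_of_Phi:
  assumes H: "in_variety H" and X: "finite X" and u: "u \<in> hcar Phi X"
  obtains u' where "special X u'"
    "\<And>\<mu> \<eta>. \<mu> \<in> Hom X H \<Longrightarrow> \<eta> \<in> Hom UNIV H \<Longrightarrow>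
      \<forall>x\<in>X. \<eta> (gen UNIV x) = \<mu> (gen X x) \<Longrightarrow>
      \<eta> \<in> Val H UNIV u' \<longleftrightarrow> \<mu> \<in> Val H X u"
proof -
  have Xs: "X \<in> sorts" using X by (simp add: sorts_def)
  obtain \<phi> where \<phi>: "\<phi> \<in> Fm X" "u = halmos_cong X `` {\<phi>}"
    using u by (auto simp: Phi_def hcar_fm_quotient)
  obtain q where q: "fo_represents H X \<phi> q"
    using fo_represents_exists[OF H Xs \<phi>(1)] by blast
  obtain p where p: "wf_fo ar p" "free_vars p \<subseteq> (\<Union>x\<in>free_vars q. tvars (Var x :: ('f, 'v) trm))"
    "bound_vars p \<inter> X = {}" "\<And>\<rho>. fo_sat H \<rho> p \<longleftrightarrow> fo_sat H (\<lambda>x. eval H \<rho> (Var x)) q"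
    using fo_subst_exists[OF infinite_vars X fo_representsD(1)[OF q], of Var H] by auto
  show thesis
  proof (rule that[of "halmos_cong UNIV `` {fo_to_hfm p}"])
    show "special X (halmos_cong UNIV `` {fo_to_hfm p})"
      using p fo_representsD(2)[OF q] unfolding special_def by (intro exI[of _ p]) auto
    fix \<mu> \<eta>
    assume \<mu>: "\<mu> \<in> Hom X H" and \<eta>: "\<eta> \<in> Hom UNIV H"
      and eq: "\<forall>x\<in>X. \<eta> (gen UNIV x) = \<mu> (gen X x)"
    have "\<mu> \<in> hinterp (Hal H) X \<phi> \<longleftrightarrow> fo_sat H (\<lambda>x. \<eta> (gen UNIV x)) q"
      using eq Hom_in_car[OF \<eta> gen_in_W] by (intro fo_representsD(3)[OF q \<mu>]) auto
    then show "\<eta> \<in> Val H UNIV (halmos_cong UNIV `` {fo_to_hfm p}) \<longleftrightarrow> \<mu> \<in> Val H X u"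
      using Val_special[OF H p(1) \<eta>] Val_class[OF H Xs \<phi>(1)] p(4) \<phi>(2) by simp
  qed
qed

text \<open>The free variables lie in X, so all extensions of \<open>\<mu>\<close> give the same
  answer and membership in \<open>Tp\<close> can be tested on a single one. For nonempty X the
  composite of \<open>\<mu>\<close> with a retraction of \<open>W UNIV\<close> onto
  \<open>W X\<close> is such an extension, and testing there is what a substitution does.\<close>

lemma Phi_of_special:
  assumes H: "in_variety H" and X: "finite X" and u: "special X u"
  obtains u' where "u' \<in> hcar Phi X"
    "\<And>\<mu>. \<mu> \<in> Hom X H \<Longrightarrow> u \<in> Tp H X \<mu> \<longleftrightarrow> \<mu> \<in> Val H X u'"
proof -
  have Xs: "X \<in> sorts" and Us: "UNIV \<in> sorts" using X by (auto simp: sorts_def)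
  have "\<exists>\<phi>\<in>Fm X. \<forall>\<mu>\<in>Hom X H. u \<in> Tp H X \<mu> \<longleftrightarrow> \<mu> \<in> hinterp (Hal H) X \<phi>"
  proof (cases "X = {}")
    case True
    text \<open>Without constants \<open>W({})\<close> is empty and receives no substitution from \<open>W(X\<^sup>0)\<close>, but then
      there is only one point.\<close>
    then have "\<mu> = \<nu>" if "\<mu> \<in> Hom X H" "\<nu> \<in> Hom X H" for \<mu> \<nu> :: "_ \<Rightarrow> 'a"
      using that by (auto intro: Hom_eqI)
    then consider "\<forall>\<mu>\<in>Hom X H. u \<in> Tp H X \<mu>" | "\<forall>\<mu>\<in>Hom X H. u \<notin> Tp H X \<mu>"
      by blast
    then show ?thesis
      by cases (auto intro: bexI[of _ HTop] bexI[of _ HBot])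
  next
    case False
    then obtain x0 where x0: "x0 \<in> X" by blast
    obtain p where p: "wf_fo ar p" "free_vars p \<subseteq> X" "u = halmos_cong UNIV `` {fo_to_hfm p}"
      using u by (auto simp: special_def)
    \<comment> \<open>Any element \<open>x0\<close> of X can receive the variables outside X; only
      the values on X influence the result.\<close>
    let ?\<rho> = "\<lambda>x. gen X (if x \<in> X then x else x0)"
    have \<rho>: "?\<rho> x \<in> car (W X)" for x using x0 by (auto intro: gen_in_W)
    let ?s = "hom_ext UNIV (W X) ?\<rho>"
    have s: "?s \<in> Hom UNIV (W X)" "\<And>x. x \<in> X \<Longrightarrow> ?s (gen UNIV x) = gen X x"
      using hom_ext_in_Hom[OF in_variety_W[OF False] \<rho>] hom_ext_gen[OF in_variety_W[OF False] \<rho>]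
      by auto
    let ?\<phi> = "HSub UNIV ?s (fo_to_hfm p)"
    have "u \<in> Tp H X \<mu> \<longleftrightarrow> \<mu> \<in> hinterp (Hal H) X ?\<phi>" if \<mu>: "\<mu> \<in> Hom X H" for \<mu>
    proof -
      let ?\<eta> = "compose (car (W UNIV)) \<mu> ?s"
      have \<eta>: "?\<eta> \<in> Hom UNIV H" "\<And>x. x \<in> X \<Longrightarrow> ?\<eta> (gen UNIV x) = \<mu> (gen X x)"
        using compose_in_Hom[OF s(1) \<mu>] s(2) gen_in_W by (auto simp: compose_eq)
      have "\<eta>' \<in> Val H UNIV u \<longleftrightarrow> ?\<eta> \<in> Val H UNIV u"
        if \<eta>': "\<eta>' \<in> Hom UNIV H" "\<forall>x\<in>X. \<eta>' (gen UNIV x) = \<mu> (gen X x)" for \<eta>'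
        unfolding p(3) Val_special[OF H p(1) \<eta>(1)] Val_special[OF H p(1) \<eta>'(1)]
        using p(2) \<eta>(2) \<eta>'(2) by (intro fo_sat_cong) auto
      then have "u \<in> Tp H X \<mu> \<longleftrightarrow> ?\<eta> \<in> Val H UNIV u"
        using u \<eta> unfolding Tp_def by blast
      also have "\<dots> \<longleftrightarrow> \<mu> \<in> hinterp (Hal H) X ?\<phi>"
        using \<mu> p Val_class[OF H Us fo_to_hfm_in_Fm] by simp
      finally show ?thesis .
    qed
    moreover have "?\<phi> \<in> Fm X"
      using Us s(1) fo_to_hfm_in_Fm[OF p(1)] by simp
    ultimately show ?thesis by blast
  qed
  then obtain \<phi> where "\<phi> \<in> Fm X" "\<forall>\<mu>\<in>Hom X H. u \<in> Tp H X \<mu> \<longleftrightarrow> \<mu> \<in> hinterp (Hal H) X \<phi>"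
    by blast
  then show thesis
    using Val_class[OF H Xs] by (intro that[of "halmos_cong X `` {\<phi>}"])
      (auto simp: Phi_def hcar_fm_quotient)
qed

section \<open>The two implications\<close>

lemma MT_definable_imp_LG_definable:
  assumes H: "in_variety H" and X: "finite X" and A: "MT_definable H X A"
  shows "LG_definable H X A"
proof -
  obtain T where T: "is_type H X T" "A = {\<mu> \<in> Hom X H. T \<subseteq> Tp H X \<mu>}"
    using A by (auto simp: MT_definable_def)
  have "\<forall>u\<in>T. \<exists>u'. u' \<in> hcar Phi X \<and>
      (\<forall>\<mu>\<in>Hom X H. u \<in> Tp H X \<mu> \<longleftrightarrow> \<mu> \<in> Val H X u')"
  proof
    fix u assume "u \<in> T"
    then have "special X u" using T(1) by (auto simp: is_type_def)
    then show "\<exists>u'. u' \<in> hcar Phi X \<and> (\<forall>\<mu>\<in>Hom X H. u \<in> Tp H X \<mu> \<longleftrightarrow> \<mu> \<in> Val H X u')"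
      by (rule Phi_of_special[OF H X]) blast
  qed
  from bchoice[OF this] obtain g where g: "\<forall>u\<in>T. g u \<in> hcar Phi X \<and>
      (\<forall>\<mu>\<in>Hom X H. u \<in> Tp H X \<mu> \<longleftrightarrow> \<mu> \<in> Val H X (g u))" ..
  \<comment> \<open>LG-definability puts no consistency demand on the defining set, so translating T
    element by element is enough, even if A is empty.\<close>
  have "A = {\<mu> \<in> Hom X H. g ` T \<subseteq> LKer H X \<mu>}"
    using g unfolding T(2) LKer_def by blast
  then show ?thesis
    unfolding LG_definable_def using g by (intro exI[of _ "g ` T"]) blast
qed

lemma LG_definable_imp_MT_definable:
  assumes H: "in_variety H" and X: "finite X" and A: "LG_definable H X A" "A \<noteq> {}"
  shows "MT_definable H X A"
proof -
  obtain T where T: "T \<subseteq> hcar Phi X" "A = {\<mu> \<in> Hom X H. T \<subseteq> LKer H X \<mu>}"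
    using A by (auto simp: LG_definable_def)
  \<comment> \<open>\<open>P u u'\<close> says that \<open>u'\<close> is decided at every extension
    of a point by the truth of u at that point. It links elements across two sorts, and this link is
    what the choice of g has to preserve.\<close>
  define P where "P u u' \<longleftrightarrow> (\<forall>\<mu>\<in>Hom X H. \<forall>\<eta>\<in>Hom UNIV H.
      (\<forall>x\<in>X. \<eta> (gen UNIV x) = \<mu> (gen X x)) \<longrightarrow> (\<eta> \<in> Val H UNIV u' \<longleftrightarrow> \<mu> \<in> Val H X u))" for u u'
  have PD: "\<eta> \<in> Val H UNIV u' \<longleftrightarrow> \<mu> \<in> Val H X u"
    if "P u u'" "\<mu> \<in> Hom X H" "\<eta> \<in> Hom UNIV H" "\<forall>x\<in>X. \<eta> (gen UNIV x) = \<mu> (gen X x)" for u u' \<mu> \<eta>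
    using that(1)[unfolded P_def, THEN bspec, OF that(2), THEN bspec, OF that(3)] that(4) by (rule mp)
  have "\<forall>u\<in>T. \<exists>u'. special X u' \<and> P u u'"
  proof
    fix u assume "u \<in> T"
    then have u: "u \<in> hcar Phi X" using T(1) by auto
    show "\<exists>u'. special X u' \<and> P u u'"
    proof (rule special_of_Phi[OF H X u])
      fix u' assume u': "special X u'"
        "\<And>\<mu> \<eta>. \<mu> \<in> Hom X H \<Longrightarrow> \<eta> \<in> Hom UNIV H \<Longrightarrow> \<forall>x\<in>X. \<eta> (gen UNIV x) = \<mu> (gen X x) \<Longrightarrow>
          \<eta> \<in> Val H UNIV u' \<longleftrightarrow> \<mu> \<in> Val H X u"
      then show ?thesis
        unfolding P_def by (intro exI[of _ u'] conjI ballI impI)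
    qed
  qed
  from bchoice[OF this] obtain g where "\<forall>u\<in>T. special X (g u) \<and> P u (g u)" ..
  then have g: "special X (g u)" "P u (g u)" if "u \<in> T" for u
    using that by simp_all
  have Tp: "g u \<in> Tp H X \<mu> \<longleftrightarrow> u \<in> LKer H X \<mu>" if u: "u \<in> T" and \<mu>: "\<mu> \<in> Hom X H" for u \<mu>
  proof -
    obtain \<eta> where \<eta>: "\<eta> \<in> Hom UNIV H" "\<forall>x\<in>X. \<eta> (gen UNIV x) = \<mu> (gen X x)"
      by (rule Hom_extend[OF H \<mu>])
    have "g u \<in> Tp H X \<mu> \<longleftrightarrow> \<mu> \<in> Val H X u"
    proof
      assume "g u \<in> Tp H X \<mu>"
      then have "\<eta> \<in> Val H UNIV (g u)" using \<eta> by (simp add: Tp_def)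
      then show "\<mu> \<in> Val H X u" by (simp only: PD[OF g(2)[OF u] \<mu> \<eta>])
    next
      assume "\<mu> \<in> Val H X u"
      then have "\<eta>' \<in> Val H UNIV (g u)"
        if "\<eta>' \<in> Hom UNIV H" "\<forall>x\<in>X. \<eta>' (gen UNIV x) = \<mu> (gen X x)" for \<eta>'
        by (simp only: PD[OF g(2)[OF u] \<mu> that])
      then show "g u \<in> Tp H X \<mu>"
        unfolding Tp_def mem_Collect_eq by (intro conjI g(1)[OF u] ballI impI)
    qed
    moreover have "u \<in> hcar Phi X" using u T(1) by auto
    ultimately show ?thesis
      by (simp add: LKer_def)
  qed
  obtain \<mu> where \<mu>: "\<mu> \<in> Hom X H" "T \<subseteq> LKer H X \<mu>"
    using A(2) unfolding T(2) by auto
  obtain \<eta> where \<eta>: "\<eta> \<in> Hom UNIV H" "\<forall>x\<in>X. \<eta> (gen UNIV x) = \<mu> (gen X x)"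
    by (rule Hom_extend[OF H \<mu>(1)])
  have \<eta>T: "\<eta> \<in> Val H UNIV (g u)" if "u \<in> T" for u
  proof -
    have "u \<in> LKer H X \<mu>" using \<mu>(2) that by (rule subsetD)
    then show ?thesis
      using PD[OF g(2)[OF that] \<mu>(1) \<eta>] by (simp add: LKer_def)
  qed
  have "is_type H X (g ` T)"
    unfolding is_type_def
  proof (intro conjI allI impI)
    show "g ` T \<subseteq> {u. special X u}" using g(1) by auto
    fix S assume "S \<subseteq> g ` T"
    then have "\<forall>u\<in>S. \<eta> \<in> Val H UNIV u" using \<eta>T by auto
    then show "\<exists>\<eta>\<in>Hom UNIV H. \<forall>u\<in>S. \<eta> \<in> Val H UNIV u" by (rule bexI[OF _ \<eta>(1)])
  qed
  moreover have "T \<subseteq> LKer H X \<mu> \<longleftrightarrow> g ` T \<subseteq> Tp H X \<mu>" if "\<mu> \<in> Hom X H" for \<mu>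
    using Tp[OF _ that] by (simp add: image_subset_iff subset_eq)
  then have "A = {\<mu> \<in> Hom X H. g ` T \<subseteq> Tp H X \<mu>}"
    unfolding T(2) by (intro Collect_cong conj_cong[OF HOL.refl])
  ultimately show ?thesis
    unfolding MT_definable_def by (intro exI[of _ "g ` T"] conjI)
qed

end

text \<open>The empty set explains the form of the claim. The class of \<open>HBot\<close> always
  LG-defines it, whereas a type must be finitely satisfiable. If there are only finitely many
  points, choosing for each point an element of T outside its \<open>Tp\<close> would give a finite
  subset of T satisfied nowhere, so no type defines the empty set. Hence the equivalence is asserted
  for nonempty A, while the passage from MT to LG holds for every A.\<close>

theorem theorem4p12:
  fixes ar :: "'f \<Rightarrow> nat"
    and E :: "(('f, 'v) trm \<times> ('f, 'v) trm) set"
    and H :: "('f, 'a) alg"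
    and X :: "'v set"
    and A :: "(('f, 'v) trm set \<Rightarrow> 'a) set"
  assumes "variety ar E"
    and "variety.in_variety ar E H"
    and "finite X"
    and "A \<subseteq> variety.Hom ar E X H"
  shows "(A \<noteq> {} \<longrightarrow> (variety.LG_definable ar E H X A \<longleftrightarrow> variety.MT_definable ar E H X A)) \<and>
         (variety.MT_definable ar E H X A \<longrightarrow> variety.LG_definable ar E H X A)"
proof -
  interpret variety ar E by (rule assms(1))
  show ?thesis
    using LG_definable_imp_MT_definable MT_definable_imp_LG_definable assms(2,3) by blast
qed

end
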